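(* Let $n,d\in\mathbb N=\{1,2,\dots\}$ with $n\ge2$. The cone $(\Sigma+C)_{n,2d}$ is closed under multiplication if and only if $(n,2d)$ is a Hilbert case. More precisely, for every non-Hilbert case $(n,2d)$ there are a form $f\in H_{n,d}$ and a nonnegative circuit $g\in H_{n,2d}$ such that $f^2\cdot g\notin(\Sigma+C)_{n,4d}$.
   Context: $(n,2d)$ (with $n\ge2$, $d\ge1$) is a Hilbert case if $n=2$, or $2d=2$, or $(n,2d)=(3,4)$; otherwise it is a non-Hilbert case. $(\Sigma+C)_{n,2d}$ is said to be closed under multiplication if $f\cdot g\in(\Sigma+C)_{n,4d}$ for all $f,g\in(\Sigma+C)_{n,2d}$. $H_{n,k}$ is the real vector space of forms of degree $k$ in $n$ variables. $\Sigma_{n,2d}\subseteq H_{n,2d}$ is the set of finite sums of squares of forms in $H_{n,d}$. For $f=\sum_\alpha f_\alpha x^\alpha\in H_{n,2d}$: $\operatorname{supp}(f)=\{\alpha\in\mathbb N_0^n:f_\alpha\neq0\}$, $\operatorname{New}(f)=\operatorname{conv}(\operatorname{supp}(f))$, $V(f)$ is the vertex set of $\operatorname{New}(f)$, $\mathcal S(f)=\{\alpha\in\operatorname{supp}(f):\alpha\in(2\mathbb N_0)^n,\ f_\alpha>0\}$, $\mathcal I(f)=\operatorname{supp}(f)\setminus\mathcal S(f)$. A form $f\in H_{n,2d}$ is a circuit if $\mathcal S(f)=V(f)$, $V(f)$ is affinely independent (single points and the empty set count as affinely independent), and either $\mathcal I(f)=\emptyset$ or $\mathcal I(f)=\{\beta\}$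 with $\beta$ in the relative interior of $\operatorname{New}(f)$. It is a nonnegative circuit if moreover $f\ge0$ on $\mathbb R^n$. $C_{n,2d}$ is the set of all finite sums of nonnegative circuits in $H_{n,2d}$. $(\Sigma+C)_{n,2d}=\{g+h: g\in\Sigma_{n,2d},\ h\in C_{n,2d}\}$. *)

theory Defs
  imports "HOL-Analysis.Analysis" "HOL-Library.Poly_Mapping"
begin

text \<open>
  The ring of real polynomials in \<open>n = CARD('n)\<close> variables is the monoid algebra of the additive
  monoid \<open>nat ^ 'n\<close> of exponents, so multiplication of polynomials is the convolution product
  of \<^theory>\<open>HOL-Library.Poly_Mapping\<close>; \<open>lookup f \<alpha>\<close> is the coefficient of \<open>x\<^sup>\<alpha>\<close>
  and \<open>keys f\<close> is \<open>supp(f)\<close>.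
\<close>

type_synonym 'n poly_n = "(nat ^ 'n) \<Rightarrow>\<^sub>0 real"

definition peval :: "'n::finite poly_n \<Rightarrow> real ^ 'n \<Rightarrow> real" where
  "peval f x = (\<Sum>\<alpha>\<in>Poly_Mapping.keys f. Poly_Mapping.lookup f \<alpha> * (\<Prod>i\<in>UNIV. (x $ i) ^ (\<alpha> $ i)))"

definition forms :: "nat \<Rightarrow> 'n::finite poly_n set" where
  "forms k = {f. \<forall>\<alpha>\<in>Poly_Mapping.keys f. (\<Sum>i\<in>UNIV. \<alpha> $ i) = k}"

text \<open>Exponents regarded as points of real n-space.\<close>

definition real_exponent :: "nat ^ 'n \<Rightarrow> real ^ 'n::finite" where
  "real_exponent \<alpha> = (\<chi> i. real (\<alpha> $ i))"

definition newton_polytope :: "'n::finite poly_n \<Rightarrow> (real ^ 'n) set" where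
  "newton_polytope f = convex hull (real_exponent ` Poly_Mapping.keys f)"

definition newton_vertices :: "'n::finite poly_n \<Rightarrow> (real ^ 'n) set" where
  "newton_vertices f = {v. v extreme_point_of newton_polytope f}"

definition square_support :: "'n::finite poly_n \<Rightarrow> (nat ^ 'n) set" where
  "square_support f = {\<alpha> \<in> Poly_Mapping.keys f. (\<forall>i. even (\<alpha> $ i)) \<and> Poly_Mapping.lookup f \<alpha> > 0}"

definition inner_support :: "'n::finite poly_n \<Rightarrow> (nat ^ 'n) set" where
  "inner_support f = Poly_Mapping.keys f - square_support f"

text \<open>The zero form is a circuit: its vertex set is empty.\<close>

definition circuit :: "nat \<Rightarrow> 'n::finite poly_n \<Rightarrow> bool" where
  "circuit k f \<longleftrightarrow>
     f \<in> forms k \<and>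
     real_exponent ` square_support f = newton_vertices f \<and>
     \<not> affine_dependent (newton_vertices f) \<and>
     (inner_support f = {} \<or>
      (\<exists>\<beta>. inner_support f = {\<beta>} \<and> real_exponent \<beta> \<in> rel_interior (newton_polytope f)))"

definition nonneg_circuit :: "nat \<Rightarrow> 'n::finite poly_n \<Rightarrow> bool" where
  "nonneg_circuit k f \<longleftrightarrow> circuit k f \<and> (\<forall>x. peval f x \<ge> 0)"

text \<open>
  The argument \<open>k\<close> of the following three cones is the full degree \<open>2d\<close>; they are only
  meaningful for even \<open>k\<close>.
\<close>

definition sos_forms :: "nat \<Rightarrow> 'n::finite poly_n set" where
  "sos_forms k = {(\<Sum>q\<leftarrow>qs. q ^ 2) | qs. set qs \<subseteq> forms (k div 2)}"

definition sonc_forms :: "nat \<Rightarrow> 'n::finite poly_n set" where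
  "sonc_forms k = {sum_list hs | hs. \<forall>h\<in>set hs. nonneg_circuit k h}"

definition sos_plus_sonc :: "nat \<Rightarrow> 'n::finite poly_n set" where
  "sos_plus_sonc k = {g + h | g h. g \<in> sos_forms k \<and> h \<in> sonc_forms k}"

definition sos_plus_sonc_mult_closed :: "'n::finite itself \<Rightarrow> nat \<Rightarrow> bool" where
  "sos_plus_sonc_mult_closed _ d \<longleftrightarrow>
     (\<forall>f \<in> (sos_plus_sonc (2 * d) :: 'n poly_n set). \<forall>g \<in> sos_plus_sonc (2 * d).
        f * g \<in> sos_plus_sonc (4 * d))"

definition hilbert_case :: "nat \<Rightarrow> nat \<Rightarrow> bool" where
  "hilbert_case n k \<longleftrightarrow> n = 2 \<or> k = 2 \<or> (n, k) = (3, 4)"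

end

theory Submission
  imports Defs "HOL-Computational_Algebra.Polynomial"
begin

text \<open>
  In the Hilbert cases every nonnegative circuit is a sum of squares: a circuit on a segment is
  a nonnegative univariate polynomial in disguise, and for ternary quartics the only other circuits
  have an inner exponent of the shape \<open>\<alpha>\<^sub>1/4 + \<alpha>\<^sub>2/4 + \<alpha>\<^sub>3/2\<close>, which two completions of the square
  settle. Products of sums of squares are sums of squares.

  In the other cases take \<open>f = \<ell>\<^sup>d\<close> for \<open>\<ell> = x\<^sub>i + x\<^sub>j + x\<^sub>k\<close> and for \<open>g\<close> a circuit that is not
  a sum of squares (a multiple of the Motzkin form, or the Choi-Lam form). If \<open>f\<^sup>2 g\<close> were a sum of
  squares and nonnegative circuits, all summands would vanish on the hyperplane \<open>\<ell> = 0\<close>. The zeros of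
  a nonzero circuit off the coordinate hyperplanes satisfy nontrivial binomial equations in \<open>|x|\<close>,
  which fail on \<open>\<ell> = 0\<close>; so the circuits are zero, each square is divisible by \<open>\<ell>\<^sup>2\<close>, and cancelling
  repeatedly makes \<open>g\<close> a sum of squares.
\<close>

section \<open>Evaluation of polynomials and sums of squares\<close>

text \<open>Three variables in \<ell> are essential to the argument: (x + y)^2 is itself a
  nonnegative circuit that vanishes on x + y = 0, whereas the vectors ln |x|, for zeros of x + y + z
  off the coordinate hyperplanes, lie on no common affine hyperplane. The power d only brings f into
  degree d. Polynomials are studied through x = exp(y). Monomials become exponentials of linear
  functionals, identities can be checked as identities of real functions, and the vertex terms of a
  circuit become convex. The sign of the inner coefficient is absorbed into an estimate with its
  absolute value; the decompositions of circuits with an inner exponent and the analysis of their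
  zeros both use nonnegativity through this estimate. That the two special circuits are not sums of
  squares rests on growth: a square r^2 below g grows along exp(t u) no faster than g, which
  confines the exponents of r to half the Newton polytope of g. There the inner exponent cannot be a
  sum of two different exponents, so its coefficient could not be negative.\<close>

definition mon :: "real ^ 'n::finite \<Rightarrow> nat ^ 'n \<Rightarrow> real" where
  "mon x \<alpha> = (\<Prod>i\<in>UNIV. (x $ i) ^ (\<alpha> $ i))"

lemma mon_0 [simp]: "mon x 0 = 1"
  by (simp add: mon_def)

lemma mon_add: "mon x (\<alpha> + \<beta>) = mon x \<alpha> * mon x \<beta>"
  by (simp add: mon_def power_add prod.distrib)

lemma mon_mult: "mon (\<chi> i. x $ i * y $ i) \<alpha> = mon x \<alpha> * mon y \<alpha>"
  by (simp add: mon_def power_mult_distrib prod.distrib)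

lemma mon_nonzero: "(\<And>i. x $ i \<noteq> 0) \<Longrightarrow> mon x \<alpha> \<noteq> 0"
  by (simp add: mon_def)

lemma mon_even_nonneg: "(\<And>i. even (\<alpha> $ i)) \<Longrightarrow> mon x \<alpha> \<ge> 0"
  by (auto simp: mon_def intro!: prod_nonneg zero_le_even_power)

lemma mon_axis [simp]: "mon x (axis i k) = x $ i ^ k"
proof -
  have "mon x (axis i k) = (\<Prod>j\<in>UNIV. if j = i then x $ i ^ k else 1)"
    unfolding mon_def by (rule prod.cong) (auto simp: axis_def)
  then show ?thesis by simp
qed

lemma peval_alt: "peval f x = (\<Sum>\<alpha>\<in>Poly_Mapping.keys f. Poly_Mapping.lookup f \<alpha> * mon x \<alpha>)"
  by (simp add: peval_def mon_def)

lemma peval_superset: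
  assumes "finite A" "Poly_Mapping.keys f \<subseteq> A"
  shows "peval f x = (\<Sum>\<alpha>\<in>A. Poly_Mapping.lookup f \<alpha> * mon x \<alpha>)"
  unfolding peval_alt using assms
  by (intro sum.mono_neutral_left) (auto simp: in_keys_iff)

lemma peval_0 [simp]: "peval 0 x = 0"
  by (simp add: peval_alt)

lemma peval_add [simp]: "peval (f + g) x = peval f x + peval g x"
proof -
  let ?A = "Poly_Mapping.keys f \<union> Poly_Mapping.keys g"
  have "peval (f + g) x = (\<Sum>\<alpha>\<in>?A. Poly_Mapping.lookup (f + g) \<alpha> * mon x \<alpha>)"
    by (rule peval_superset) (auto dest: set_mp[OF Poly_Mapping.keys_add])
  also have "\<dots> = peval f x + peval g x"
    by (simp add: lookup_add algebra_simps sum.distrib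
        peval_superset[of ?A f] peval_superset[of ?A g])
  finally show ?thesis .
qed

lemma peval_uminus [simp]: "peval (- f) x = - peval f x"
  using peval_add[of f "- f" x] by simp

lemma peval_diff [simp]: "peval (f - g) x = peval f x - peval g x"
  using peval_add[of f "- g" x] by simp

lemma peval_single [simp]: "peval (Poly_Mapping.single \<alpha> c) x = c * mon x \<alpha>"
  by (cases "c = 0") (simp_all add: peval_alt)

lemma peval_sum: "peval (sum f A) x = (\<Sum>a\<in>A. peval (f a) x)"
  by (induction A rule: infinite_finite_induct) auto

lemma peval_sum_list: "peval (sum_list fs) x = (\<Sum>f\<leftarrow>fs. peval f x)"
  by (induction fs) auto

lemma poly_mapping_sum_singles:
  assumes "finite A" "Poly_Mapping.keys f \<subseteq> A"
  shows "f = (\<Sum>\<alpha>\<in>A. Poly_Mapping.single \<alpha> (Poly_Mapping.lookup f \<alpha>))"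
  using assms by (intro poly_mapping_eqI)
    (auto simp: lookup_sum lookup_single when_def in_keys_iff)

lemma peval_mult [simp]: "peval (f * g) x = peval f x * peval g x"
proof -
  let ?F = "Poly_Mapping.keys f" and ?G = "Poly_Mapping.keys g"
  have "f * g = (\<Sum>\<alpha>\<in>?F. Poly_Mapping.single \<alpha> (Poly_Mapping.lookup f \<alpha>)) *
      (\<Sum>\<beta>\<in>?G. Poly_Mapping.single \<beta> (Poly_Mapping.lookup g \<beta>))"
    using poly_mapping_sum_singles[of ?F f] poly_mapping_sum_singles[of ?G g] by simp
  also have "\<dots> = (\<Sum>\<alpha>\<in>?F. \<Sum>\<beta>\<in>?G.
      Poly_Mapping.single (\<alpha> + \<beta>) (Poly_Mapping.lookup f \<alpha> * Poly_Mapping.lookup g \<beta>))"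
    by (simp add: sum_product mult_single)
  finally have "peval (f * g) x = (\<Sum>\<alpha>\<in>?F. \<Sum>\<beta>\<in>?G.
      Poly_Mapping.lookup f \<alpha> * Poly_Mapping.lookup g \<beta> * mon x (\<alpha> + \<beta>))"
    by (simp add: peval_sum)
  also have "\<dots> = peval f x * peval g x"
    by (simp add: peval_alt mon_add sum_product mult_ac)
  finally show ?thesis .
qed

lemma peval_1 [simp]: "peval 1 x = 1"
  using peval_single[of 0 1 x] by simp

lemma peval_power [simp]: "peval (f ^ k) x = peval f x ^ k"
  by (induction k) auto

definition expv :: "real ^ 'n \<Rightarrow> real ^ 'n::finite" where
  "expv y = (\<chi> i. exp (y $ i))"

lemma mon_expv: "mon (expv y) \<alpha> = exp (real_exponent \<alpha> \<bullet> y)"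
  by (simp add: mon_def expv_def real_exponent_def inner_vec_def exp_sum exp_of_nat_mult)

lemma peval_expv:
  "peval f (expv y) = (\<Sum>\<alpha>\<in>Poly_Mapping.keys f. Poly_Mapping.lookup f \<alpha> * exp (real_exponent \<alpha> \<bullet> y))"
  by (simp add: peval_alt mon_expv)

lemma real_exponent_nth [simp]: "real_exponent \<alpha> $ i = real (\<alpha> $ i)"
  by (simp add: real_exponent_def)

lemma real_exponent_add: "real_exponent (\<alpha> + \<beta>) = real_exponent \<alpha> + real_exponent \<beta>"
  by (simp add: vec_eq_iff)

lemma inj_real_exponent: "inj real_exponent"
  by (auto simp: inj_def vec_eq_iff)

lemma real_exponent_eq_iff [simp]: "real_exponent \<alpha> = real_exponent \<beta> \<longleftrightarrow> \<alpha> = \<beta>"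
  using inj_real_exponent by (auto simp: inj_def)

text \<open>Dedekind's argument: comparing the values at \<open>y\<close> and at \<open>y + e\<^sub>i\<close> eliminates one character.\<close>

lemma exponentials_independent:
  fixes c :: "nat ^ 'n::finite \<Rightarrow> real"
  assumes "finite S" "\<And>y. (\<Sum>\<alpha>\<in>S. c \<alpha> * exp (real_exponent \<alpha> \<bullet> y)) = 0" "\<alpha> \<in> S"
  shows "c \<alpha> = 0"
  using assms
proof (induction S arbitrary: c \<alpha> rule: finite_induct)
  case (insert \<beta> S)
  have c: "c \<alpha> = 0" if "\<alpha> \<in> S" for \<alpha>
  proof -
    have "\<alpha> \<noteq> \<beta>" using that insert.hyps by auto
    then obtain i where i: "\<alpha> $ i \<noteq> \<beta> $ i"
      by (auto simp: vec_eq_iff)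
    define c' where "c' \<gamma> = c \<gamma> * (exp (\<gamma> $ i) - exp (\<beta> $ i))" for \<gamma>
    have "(\<Sum>\<gamma>\<in>S. c' \<gamma> * exp (real_exponent \<gamma> \<bullet> y)) = 0" for y
    proof -
      let ?s = "\<lambda>y. \<Sum>\<gamma>\<in>insert \<beta> S. c \<gamma> * exp (real_exponent \<gamma> \<bullet> y)"
      have "0 = ?s (y + axis i 1) - exp (\<beta> $ i) * ?s y"
        using insert.prems(1) by simp
      also have "\<dots> = (\<Sum>\<gamma>\<in>insert \<beta> S. c' \<gamma> * exp (real_exponent \<gamma> \<bullet> y))"
        unfolding sum_distrib_left sum_subtractf[symmetric]
        by (intro sum.cong) (auto simp: c'_def inner_add_right inner_axis exp_add algebra_simps)
      also have "\<dots> = (\<Sum>\<gamma>\<in>S. c' \<gamma> * exp (real_exponent \<gamma> \<bullet> y))"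
        using insert.hyps by (simp add: c'_def)
      finally show ?thesis by simp
    qed
    from insert.IH[OF this that] i show ?thesis by (simp add: c'_def)
  qed
  moreover have "c \<beta> = 0"
    using insert.prems(1)[of 0] insert.hyps c by simp
  ultimately show ?case using insert.prems by auto
qed simp

text \<open>By independence of the exponentials the difference has no nonzero coefficient.
  Polynomial identities can thus be verified in the reals, where all monomials are positive and may
  be divided by.\<close>

lemma poly_mapping_eqI_expv:
  assumes "\<And>y. peval f (expv y) = peval g (expv y)"
  shows "f = g"
proof -
  have "Poly_Mapping.lookup (f - g) \<alpha> = 0" for \<alpha>
  proof (cases "\<alpha> \<in> Poly_Mapping.keys (f - g)")
    case True
    show ?thesis
    proof (rule exponentials_independent[OF _ _ True])
      show "(\<Sum>\<alpha>\<in>Poly_Mapping.keys (f - g).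
          Poly_Mapping.lookup (f - g) \<alpha> * exp (real_exponent \<alpha> \<bullet> y)) = 0" for y
        using assms peval_expv[of "f - g" y] by simp
    qed simp
  qed (simp add: in_keys_iff)
  then show ?thesis
    by (metis eq_iff_diff_eq_0 lookup_zero poly_mapping_eqI)
qed

section \<open>Forms of fixed degree and the cone of sums of squares\<close>

lemma forms_0 [simp]: "0 \<in> forms k"
  by (simp add: forms_def)

lemma forms_add: "f \<in> forms k \<Longrightarrow> g \<in> forms k \<Longrightarrow> f + g \<in> forms k"
  using Poly_Mapping.keys_add[of f g] by (auto simp: forms_def)

lemma forms_diff: "f \<in> forms k \<Longrightarrow> g \<in> forms k \<Longrightarrow> f - g \<in> forms k"
  using keys_diff[of f g] by (auto simp: forms_def)

lemma forms_sum: "(\<And>a. a \<in> A \<Longrightarrow> f a \<in> forms k) \<Longrightarrow> sum f A \<in> forms k"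
  by (induction A rule: infinite_finite_induct) (auto intro: forms_add)

lemma forms_mult: "f \<in> forms k \<Longrightarrow> g \<in> forms l \<Longrightarrow> f * g \<in> forms (k + l)"
  using Poly_Mapping.keys_mult[of f g] by (fastforce simp: forms_def sum.distrib)

lemma forms_single: "(\<Sum>i\<in>UNIV. \<alpha> $ i) = k \<Longrightarrow> Poly_Mapping.single \<alpha> c \<in> forms k"
  by (auto simp: forms_def)

lemma forms_power: "f \<in> forms k \<Longrightarrow> f ^ m \<in> forms (m * k)"
proof (induction m)
  case 0
  show ?case using forms_single[of "0::nat ^ 'a" 0 1] by simp
qed (auto dest: forms_mult)

lemma sos_forms_0 [simp]: "0 \<in> sos_forms k"
  by (auto simp: sos_forms_def intro!: exI[of _ "[]"])

lemma sos_forms_add: "f \<in> sos_forms k \<Longrightarrow> g \<in> sos_forms k \<Longrightarrow> f + g \<in> sos_forms k"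
  unfolding sos_forms_def
proof safe
  fix ps qs :: "'a poly_n list"
  assume "set ps \<subseteq> forms (k div 2)" "set qs \<subseteq> forms (k div 2)"
  then show "\<exists>rs. (\<Sum>q\<leftarrow>ps. q\<^sup>2) + (\<Sum>q\<leftarrow>qs. q\<^sup>2) = (\<Sum>q\<leftarrow>rs. q\<^sup>2) \<and> set rs \<subseteq> forms (k div 2)"
    by (intro exI[of _ "ps @ qs"]) auto
qed

lemma sos_forms_sum: "(\<And>a. a \<in> A \<Longrightarrow> f a \<in> sos_forms k) \<Longrightarrow> sum f A \<in> sos_forms k"
  by (induction A rule: infinite_finite_induct) (auto intro: sos_forms_add)

lemma sos_forms_sum_list: "(\<And>f. f \<in> set fs \<Longrightarrow> f \<in> sos_forms k) \<Longrightarrow> sum_list fs \<in> sos_forms k"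
  by (induction fs) (auto intro: sos_forms_add)

lemma sos_forms_square: "f \<in> forms d \<Longrightarrow> f ^ 2 \<in> sos_forms (2 * d)"
  by (auto simp: sos_forms_def intro!: exI[of _ "[f]"])

lemma sos_forms_mult:
  assumes "f \<in> sos_forms (2 * d)" "g \<in> sos_forms (2 * e)"
  shows "f * g \<in> sos_forms (2 * (d + e))"
proof -
  obtain ps qs where f: "f = (\<Sum>q\<leftarrow>ps. q ^ 2)" "set ps \<subseteq> forms d"
    and g: "g = (\<Sum>q\<leftarrow>qs. q ^ 2)" "set qs \<subseteq> forms e"
    using assms by (auto simp: sos_forms_def)
  have "f * g = (\<Sum>p\<leftarrow>ps. \<Sum>q\<leftarrow>qs. (p * q) ^ 2)"
    unfolding f g
    by (simp add: sum_list_const_mult sum_list_mult_const power_mult_distrib)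
  also have "\<dots> \<in> sos_forms (2 * (d + e))"
    using f(2) g(2) by (auto simp: subset_iff simp del: distrib_left_numeral
        intro!: sos_forms_sum_list sos_forms_square forms_mult)
  finally show ?thesis .
qed

lemma sonc_forms_0 [simp]: "0 \<in> sonc_forms k"
  by (auto simp: sonc_forms_def intro!: exI[of _ "[]"])

section \<open>Circuits on segments and triangles\<close>

text \<open>Subtracting the minimum creates a double root, which can be split off.\<close>

lemma nonneg_poly_sos:
  fixes p :: "real poly"
  assumes "\<And>x. poly p x \<ge> 0"
  shows "\<exists>qs. p = (\<Sum>q\<leftarrow>qs. q ^ 2) \<and> (\<forall>q\<in>set qs. 2 * degree q \<le> degree p)"
  using assms
proof (induction "degree p" arbitrary: p rule: less_induct)
  case less
  show ?case
  proof (cases "degree p = 0")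
    case True
    then obtain c where c: "p = [:c:]" by (metis degree_eq_zeroE)
    then have "c \<ge> 0" using less.prems[of 0] by simp
    then show ?thesis using c
      by (intro exI[of _ "[[:sqrt c:]]"]) (simp add: power2_eq_square)
  next
    case False
    \<comment> \<open>A nonconstant polynomial is unbounded in absolute value at infinity, and
      nonnegativity removes the absolute value. Outside a ball the values are therefore at least
      \<open>poly p 0\<close>, so the minimum over the ball is global.\<close>
    have "filterlim (poly p) at_infinity at_infinity"
      using False by (intro filterlim_poly_at_infinity) auto
    then have "\<forall>\<^sub>F x in at_infinity. norm (poly p x) \<ge> poly p 0"
      by (simp only: filterlim_at_infinity_conv_norm_at_top filterlim_at_top)
    then obtain B where B: "\<And>x. norm x \<ge> B \<Longrightarrow> norm (poly p x) \<ge> poly p 0"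
      by (auto simp: eventually_at_infinity)
    have "\<exists>a\<in>cball 0 \<bar>B\<bar>. \<forall>x\<in>cball 0 \<bar>B\<bar>. poly p a \<le> poly p x"
      by (rule continuous_attains_inf) (auto intro: continuous_intros)
    then obtain a where a: "\<And>x. x \<in> cball 0 \<bar>B\<bar> \<Longrightarrow> poly p a \<le> poly p x" by blast
    have min: "poly p a \<le> poly p x" for x
    proof (cases "x \<in> cball 0 \<bar>B\<bar>")
      case False
      then have "poly p 0 \<le> poly p x" using B[of x] less.prems[of x] by auto
      then show ?thesis using a[of 0] by simp
    qed (use a in auto)
    obtain r where r: "p - [:poly p a:] = [:- a, 1:] * r"
      by (metis (no_types, lifting) diff_self dvdE poly_diff poly_eq_0_iff_dvd poly_pCons
          poly_0 mult_zero_right add.right_neutral)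
    have p: "p = [:poly p a:] + [:- a, 1:] * r" using r by (simp add: algebra_simps)
    \<comment> \<open>The derivative vanishes at the minimum, and by the product rule its value
      there is r(a); hence X - a divides r once more.\<close>
    have "poly (pderiv p) a = 0"
      using DERIV_local_min[of "poly p" "poly (pderiv p) a" a 1] min by auto
    moreover have "pderiv p = r + [:- a, 1:] * pderiv r"
      by (subst p) (simp add: pderiv_add pderiv_mult pderiv_pCons del: mult_pCons_left)
    ultimately have "poly r a = 0" by simp
    then obtain s where s: "r = [:- a, 1:] * s"
      by (auto simp: poly_eq_0_iff_dvd elim: dvdE)
    have ps: "p = [:poly p a:] + [:- a, 1:] ^ 2 * s"
      using p unfolding s power2_eq_square mult.assoc .
    have nz: "s \<noteq> 0" using ps False by (metis add.right_neutral degree_pCons_0 mult_zero_right)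
    have s_eq: "poly p x = poly p a + (x - a) ^ 2 * poly s x" for x
      by (subst ps) simp
    have s1: "poly s x \<ge> 0" if "x \<noteq> a" for x
      using min[of x] s_eq[of x] that by (auto simp: zero_le_mult_iff)
    have "poly s x \<ge> 0" for x
    proof (cases "x = a")
      case True
      \<comment> \<open>Division by (x - a)^2 says nothing at a itself; continuity carries the sign
        over.\<close>
      have "(poly s \<longlongrightarrow> poly s a) (at a)"
        by (rule isContD) (rule poly_isCont)
      then have "0 \<le> poly s a"
        by (rule tendsto_lowerbound) (auto simp: eventually_at_filter s1)
      then show ?thesis using True by simp
    qed (use s1 in auto)
    moreover have deg: "degree p = 2 + degree s"
    proof -
      have d: "degree ([:- a, 1:] ^ 2 * s) = 2 + degree s"
        using nz by (simp add: degree_mult_eq degree_power_eq)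
      show ?thesis
        by (subst ps, subst degree_add_eq_right) (simp_all add: d del: mult_pCons_left)
    qed
    ultimately obtain qs where qs: "s = (\<Sum>q\<leftarrow>qs. q ^ 2)" "\<forall>q\<in>set qs. 2 * degree q \<le> degree s"
      using less.hyps[of s] by auto
    have pa: "poly p a \<ge> 0" using less.prems by simp
    show ?thesis
    proof (intro exI conjI)
      have "p = [:poly p a:] + [:- a, 1:] ^ 2 * (\<Sum>q\<leftarrow>qs. q ^ 2)"
        using ps qs by simp
      also have "[:poly p a:] = [:sqrt (poly p a):] ^ 2"
        using pa by (simp add: power2_eq_square)
      finally show "p = (\<Sum>q\<leftarrow>[:sqrt (poly p a):] # map (\<lambda>q. [:- a, 1:] * q) qs. q ^ 2)"
        by (simp add: sum_list_const_mult[symmetric] power_mult_distrib o_def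
            del: mult_pCons_left)
      show "\<forall>q\<in>set ([:sqrt (poly p a):] # map (\<lambda>q. [:- a, 1:] * q) qs). 2 * degree q \<le> degree p"
      proof (clarsimp simp del: mult_pCons_left)
        fix q assume "q \<in> set qs"
        then have "2 * degree q \<le> degree s" using qs by auto
        moreover have "degree ([:- a, 1:] * q) \<le> 1 + degree q"
          using degree_mult_le[of "[:- a, 1:]" q] by simp
        ultimately show "2 * degree ([:- a, 1:] * q) \<le> degree p" using deg by linarith
      qed
    qed
  qed
qed

lemma abs_mult_power_le: "(c::real) * s ^ m \<ge> - \<bar>c\<bar> * \<bar>s\<bar> ^ m"
  by (metis abs_ge_minus_self abs_mult abs_minus_cancel minus_le_iff mult_minus_left power_abs)

lemma exp_power_eq: "exp (real k * x) = exp x ^ k"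
  by (simp add: exp_of_nat_mult)

text \<open>
  A circuit supported on a segment becomes a univariate polynomial in \<open>s = x\<^sup>w\<close>, where \<open>w\<close>
  is an integral direction vector for which both \<open>\<gamma>\<^sub>2 - \<gamma>\<^sub>1\<close> and \<open>\<beta> - 2\<gamma>\<^sub>1\<close> are integral multiples.
\<close>

lemma segment_circuit_sos:
  fixes \<gamma>1 \<gamma>2 \<beta> :: "nat ^ 'n::finite"
  assumes ne: "\<gamma>1 \<noteq> \<gamma>2"
    and sums: "(\<Sum>i\<in>UNIV. \<gamma>1 $ i) = d" "(\<Sum>i\<in>UNIV. \<gamma>2 $ i) = d"
    and u: "0 < u" "u < 1"
    and \<beta>: "\<And>i. real (\<beta> $ i) = (1 - u) * (2 * real (\<gamma>1 $ i)) + u * (2 * real (\<gamma>2 $ i))"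
    and ab: "a > 0" "b > 0"
    and bound: "\<And>y. \<bar>c\<bar> * exp (real_exponent \<beta> \<bullet> y) \<le>
       a * exp (2 * (real_exponent \<gamma>1 \<bullet> y)) + b * exp (2 * (real_exponent \<gamma>2 \<bullet> y))"
  shows "Poly_Mapping.single (\<gamma>1 + \<gamma>1) a + Poly_Mapping.single (\<gamma>2 + \<gamma>2) b
    + Poly_Mapping.single \<beta> c \<in> sos_forms (2 * d)"
proof -
  obtain i0 where i0: "\<gamma>1 $ i0 \<noteq> \<gamma>2 $ i0" using ne by (auto simp: vec_eq_iff)
  \<comment> \<open>Integrality of the exponents makes \<open>2 * u\<close> rational. With m / k in
    lowest terms, \<beta> = 2\<gamma>1 + (m / k)(\<gamma>2 - \<gamma>1), and coprimality forces k to
    divide every entry of \<gamma>2 - \<gamma>1. The quotient is the direction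
    \<open>w\<close>.\<close>
  have "2 * u = (real (\<beta> $ i0) - 2 * real (\<gamma>1 $ i0)) / (real (\<gamma>2 $ i0) - real (\<gamma>1 $ i0))"
    using i0 \<beta>[of i0] by (simp add: field_simps)
  then have "2 * u \<in> \<rat>" by simp
  then obtain m k :: nat where k: "k \<noteq> 0" and mk: "2 * u = real m / real k" and cop: "coprime m k"
    using u by (metis Rats_abs_nat_div_natE abs_of_pos mult_pos_pos zero_less_numeral)
  have m: "0 < m" "m < 2 * k"
  proof -
    have "real m = 2 * u * real k" using mk k by (simp add: field_simps)
    then have "real m > 0" "real m < real (2 * k)" using u k by auto
    then show "0 < m" "m < 2 * k" by linarith+
  qed
  have key: "int k * (int (\<beta> $ i) - 2 * int (\<gamma>1 $ i)) = int m * (int (\<gamma>2 $ i) - int (\<gamma>1 $ i))" for i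
  proof -
    have "real (\<beta> $ i) - 2 * real (\<gamma>1 $ i) = (2 * u) * (real (\<gamma>2 $ i) - real (\<gamma>1 $ i))"
      using \<beta>[of i] by (simp add: algebra_simps)
    then have "real k * (real (\<beta> $ i) - 2 * real (\<gamma>1 $ i)) = real m * (real (\<gamma>2 $ i) - real (\<gamma>1 $ i))"
      unfolding mk using k by (simp add: field_simps)
    then have "real_of_int (int k * (int (\<beta> $ i) - 2 * int (\<gamma>1 $ i)))
        = real_of_int (int m * (int (\<gamma>2 $ i) - int (\<gamma>1 $ i)))" by simp
    then show ?thesis by linarith
  qed
  define w where "w i = (int (\<gamma>2 $ i) - int (\<gamma>1 $ i)) div int k" for i
  have w1: "int (\<gamma>2 $ i) - int (\<gamma>1 $ i) = int k * w i" for i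
  proof -
    have "int k dvd int m * (int (\<gamma>2 $ i) - int (\<gamma>1 $ i))" by (metis key dvd_triv_left)
    then have "int k dvd int (\<gamma>2 $ i) - int (\<gamma>1 $ i)"
      using cop by (simp add: coprime_dvd_mult_right_iff coprime_commute)
    then show ?thesis by (simp add: w_def)
  qed
  have w2: "int (\<beta> $ i) - 2 * int (\<gamma>1 $ i) = int m * w i" for i
    using key[of i] k by (simp add: w1)
  define W :: "real ^ 'n" where "W = (\<chi> i. of_int (w i))"
  have W1: "real_exponent \<gamma>2 = real_exponent \<gamma>1 + real k *\<^sub>R W"
    using arg_cong[OF w1, of real_of_int] by (simp add: vec_eq_iff W_def algebra_simps)
  have W2: "real_exponent \<beta> = 2 *\<^sub>R real_exponent \<gamma>1 + real m *\<^sub>R W"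
    using arg_cong[OF w2, of real_of_int] by (simp add: vec_eq_iff W_def algebra_simps)
  have "W \<noteq> 0" using W1 ne by auto
  \<comment> \<open>The circuit divided by the monomial of 2\<gamma>1: its three exponents sit 0, m
    and 2k steps of \<open>w\<close> away from there.\<close>
  define p :: "real poly" where "p = monom a 0 + monom c m + monom b (2 * k)"
  have poly_p: "poly p s = a + c * s ^ m + b * s ^ (2 * k)" for s
    by (simp add: p_def poly_monom)
  have "poly p s \<ge> 0" for s
  \<comment> \<open>The bound speaks of positive points only. For nonzero s it is applied at the
    multiple y of \<open>W\<close> with W . y = ln |s|, and |c| covers both signs of s. At s = 0
    only the constant a remains, as m and k are positive.\<close>
  proof (cases "s = 0")
    case True
    then show ?thesis using ab m k by (simp add: poly_p power_0_left)
  next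
    case False
    define y where "y = (ln \<bar>s\<bar> / (W \<bullet> W)) *\<^sub>R W"
    define E where "E = exp (2 * (real_exponent \<gamma>1 \<bullet> y))"
    have Wy: "W \<bullet> y = ln \<bar>s\<bar>" using \<open>W \<noteq> 0\<close> by (simp add: y_def)
    have pw: "exp (real j * (W \<bullet> y)) = \<bar>s\<bar> ^ j" for j
      using False by (simp add: exp_power_eq Wy)
    have "exp (real_exponent \<beta> \<bullet> y) = E * \<bar>s\<bar> ^ m"
      by (simp add: W2 inner_add_left exp_add pw E_def)
    moreover have "exp (2 * (real_exponent \<gamma>2 \<bullet> y)) = E * \<bar>s\<bar> ^ (2 * k)"
      using pw[of "2 * k"] by (simp add: W1 inner_add_left exp_add E_def algebra_simps)
    ultimately have "\<bar>c\<bar> * (E * \<bar>s\<bar> ^ m) \<le> a * E + b * (E * \<bar>s\<bar> ^ (2 * k))"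
      using bound[of y] by (simp add: E_def)
    then have "E * (\<bar>c\<bar> * \<bar>s\<bar> ^ m) \<le> E * (a + b * \<bar>s\<bar> ^ (2 * k))"
      by (simp add: algebra_simps)
    then have "\<bar>c\<bar> * \<bar>s\<bar> ^ m \<le> a + b * \<bar>s\<bar> ^ (2 * k)"
      by (simp add: E_def)
    then show ?thesis
      using abs_mult_power_le[of c s m] by (simp add: poly_p power_even_abs)
  qed
  from nonneg_poly_sos[OF this] obtain qs
    where qs: "p = (\<Sum>q\<leftarrow>qs. q ^ 2)" "\<forall>q\<in>set qs. 2 * degree q \<le> degree p" by blast
  have "degree p \<le> 2 * k"
    unfolding p_def using m by (intro degree_add_le) (auto intro: order.trans[OF degree_monom_le])
  then have deg: "degree q \<le> k" if "q \<in> set qs" for q using qs(2) that by fastforce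
  \<comment> \<open>Lifts s^j back to an exponent. For j at most k it lies on the segment from
    \<gamma>1 to \<gamma>2, so its entries are nonnegative and \<open>nat\<close> changes nothing;
    the polynomials q have degree at most k, so no larger j is needed.\<close>
  define \<delta> :: "nat \<Rightarrow> nat ^ 'n" where "\<delta> j = (\<chi> i. nat (int (\<gamma>1 $ i) + int j * w i))" for j
  have \<delta>: "int (\<delta> j $ i) = int (\<gamma>1 $ i) + int j * w i" if "j \<le> k" for i j
  proof -
    have "int k * (int (\<gamma>1 $ i) + int j * w i) = int (k - j) * int (\<gamma>1 $ i) + int j * int (\<gamma>2 $ i)"
      using w1[of i] that by (simp add: of_nat_diff algebra_simps)
    also have "\<dots> \<ge> 0" by simp
    finally have "int (\<gamma>1 $ i) + int j * w i \<ge> 0"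
      using k by (simp add: zero_le_mult_iff)
    then show ?thesis by (simp add: \<delta>_def)
  qed
  have \<delta>_real: "real_exponent (\<delta> j) = real_exponent \<gamma>1 + real j *\<^sub>R W" if "j \<le> k" for j
    using arg_cong[OF \<delta>[OF that], of real_of_int] by (simp add: vec_eq_iff W_def)
  \<comment> \<open>Both ends have degree d, so \<open>w\<close> has total degree 0 and every
    \<delta> j up to k again has degree d.\<close>
  have "int k * (\<Sum>i\<in>UNIV. w i) = (\<Sum>i\<in>UNIV. int (\<gamma>2 $ i)) - (\<Sum>i\<in>UNIV. int (\<gamma>1 $ i))"
    by (simp add: sum_distrib_left w1[symmetric] sum_subtractf)
  also have "\<dots> = 0" using sums by (simp flip: of_nat_sum)
  finally have w0: "(\<Sum>i\<in>UNIV. w i) = 0" using k by simp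
  have \<delta>_sum: "(\<Sum>i\<in>UNIV. \<delta> j $ i) = d" if "j \<le> k" for j
  proof -
    have "int (\<Sum>i\<in>UNIV. \<delta> j $ i) = (\<Sum>i\<in>UNIV. int (\<gamma>1 $ i)) + int j * (\<Sum>i\<in>UNIV. w i)"
      by (simp add: \<delta>[OF that] sum.distrib sum_distrib_left)
    also have "\<dots> = int d" using sums w0 by (simp flip: of_nat_sum)
    finally show ?thesis by linarith
  qed
  define h where "h q = (\<Sum>j\<le>k. Poly_Mapping.single (\<delta> j) (coeff q j))" for q :: "real poly"
  have "peval (h q) (expv y) = exp (real_exponent \<gamma>1 \<bullet> y) * poly q (exp (W \<bullet> y))"
    if "q \<in> set qs" for q y
  proof -
    have "peval (h q) (expv y) = (\<Sum>j\<le>k. coeff q j * exp (real_exponent (\<delta> j) \<bullet> y))"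
      by (simp add: h_def peval_sum mon_expv)
    also have "\<dots> = (\<Sum>j\<le>k. coeff q j * (exp (real_exponent \<gamma>1 \<bullet> y) * exp (W \<bullet> y) ^ j))"
      by (intro sum.cong) (auto simp: \<delta>_real inner_add_left exp_add exp_power_eq)
    also have "\<dots> = exp (real_exponent \<gamma>1 \<bullet> y) * (\<Sum>j\<le>k. coeff q j * exp (W \<bullet> y) ^ j)"
      by (simp add: sum_distrib_left algebra_simps)
    also have "(\<Sum>j\<le>k. coeff q j * exp (W \<bullet> y) ^ j) = poly q (exp (W \<bullet> y))"
      unfolding poly_altdef using deg[OF that]
      by (intro sum.mono_neutral_right) (auto simp: coeff_eq_0)
    finally show ?thesis .
  qed
  note h = this
  have "Poly_Mapping.single (\<gamma>1 + \<gamma>1) a + Poly_Mapping.single (\<gamma>2 + \<gamma>2) b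
    + Poly_Mapping.single \<beta> c = (\<Sum>q\<leftarrow>qs. h q ^ 2)" (is "?f = _")
  proof (rule poly_mapping_eqI_expv)
    fix y :: "real ^ 'n"
    define E where "E = exp (real_exponent \<gamma>1 \<bullet> y)"
    define s where "s = exp (W \<bullet> y)"
    have pw: "exp (real j * (W \<bullet> y)) = s ^ j" for j
      by (simp add: exp_power_eq s_def)
    have "peval ?f (expv y) = a * E ^ 2 + b * (E * s ^ k) ^ 2 + c * (E ^ 2 * s ^ m)"
      by (simp add: mon_add power2_eq_square mon_expv W1 W2 inner_add_left exp_add pw E_def
          exp_double)
    also have "\<dots> = E ^ 2 * poly p s"
      by (simp add: poly_p algebra_simps power_mult_distrib power_mult[symmetric])
    also have "\<dots> = (\<Sum>q\<leftarrow>qs. (E * poly q s) ^ 2)"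
      unfolding qs(1) by (induction qs) (simp_all add: algebra_simps power_mult_distrib)
    also have "\<dots> = (\<Sum>q\<leftarrow>qs. peval (h q) (expv y) ^ 2)"
      by (intro arg_cong[of _ _ sum_list] map_cong) (auto simp: h E_def s_def)
    also have "\<dots> = peval (\<Sum>q\<leftarrow>qs. h q ^ 2) (expv y)"
      by (simp add: peval_sum_list o_def)
    finally show "peval ?f (expv y) = peval (\<Sum>q\<leftarrow>qs. h q ^ 2) (expv y)" .
  qed
  also have "\<dots> \<in> sos_forms (2 * d)"
    by (intro sos_forms_sum_list)
      (auto intro!: sos_forms_square forms_sum forms_single simp: h_def \<delta>_sum)
  finally show ?thesis .
qed

text \<open>Splitting off the square of sqrt a x^\<gamma>1 - sqrt b x^\<gamma>2 turns the first two
  terms into P x^(2\<eta>) with P = 2 sqrt (a b). What remains is a binary quadratic form in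
  x^\<eta> and x^\<gamma>3, so only its discriminant matters. The hypothesis \<open>indep\<close>
  provides a point where the bound becomes exactly the discriminant inequality.\<close>

lemma triangle_circuit_sos:
  fixes \<gamma>1 \<gamma>2 \<gamma>3 \<eta> :: "nat ^ 'n::finite"
  assumes \<eta>: "\<gamma>1 + \<gamma>2 = \<eta> + \<eta>"
    and sums: "(\<Sum>i\<in>UNIV. \<gamma>1 $ i) = d" "(\<Sum>i\<in>UNIV. \<gamma>2 $ i) = d" "(\<Sum>i\<in>UNIV. \<gamma>3 $ i) = d"
    and indep: "\<And>s t. \<exists>y. real_exponent \<gamma>1 \<bullet> y - real_exponent \<gamma>2 \<bullet> y = s \<and>
      real_exponent \<eta> \<bullet> y - real_exponent \<gamma>3 \<bullet> y = t"
    and pos: "a > 0" "b > 0" "e > 0"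
    and bound: "\<And>y. \<bar>c\<bar> * exp (real_exponent (\<eta> + \<gamma>3) \<bullet> y) \<le>
       a * exp (2 * (real_exponent \<gamma>1 \<bullet> y)) + b * exp (2 * (real_exponent \<gamma>2 \<bullet> y))
       + e * exp (2 * (real_exponent \<gamma>3 \<bullet> y))"
  shows "Poly_Mapping.single (\<gamma>1 + \<gamma>1) a + Poly_Mapping.single (\<gamma>2 + \<gamma>2) b
    + Poly_Mapping.single (\<gamma>3 + \<gamma>3) e + Poly_Mapping.single (\<eta> + \<gamma>3) c \<in> sos_forms (2 * d)"
proof -
  define P where "P = 2 * (sqrt a * sqrt b)"
  have P: "P > 0" using pos by (simp add: P_def)
  have \<eta>_real: "real_exponent \<gamma>1 \<bullet> y + real_exponent \<gamma>2 \<bullet> y = 2 * (real_exponent \<eta> \<bullet> y)" for y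
    using arg_cong[OF \<eta>, of "\<lambda>\<alpha>. real_exponent \<alpha> \<bullet> y"]
    unfolding real_exponent_add inner_add_left by simp
  \<comment> \<open>The two logarithms encode equality in both AM-GM steps: sqrt a A = sqrt b B and
    sqrt P M = sqrt e N. There the right-hand side of the bound collapses to 2 sqrt (P e) M
    N.\<close>
  obtain y where y1: "real_exponent \<gamma>1 \<bullet> y - real_exponent \<gamma>2 \<bullet> y = ln (sqrt b / sqrt a)"
    and y2: "real_exponent \<eta> \<bullet> y - real_exponent \<gamma>3 \<bullet> y = ln (sqrt e / sqrt P)"
    using indep by blast
  define A B N M where "A = exp (real_exponent \<gamma>1 \<bullet> y)" and "B = exp (real_exponent \<gamma>2 \<bullet> y)"
    and "N = exp (real_exponent \<gamma>3 \<bullet> y)" and "M = exp (real_exponent \<eta> \<bullet> y)"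
  have gt: "A > 0" "B > 0" "N > 0" "M > 0" by (auto simp: A_def B_def N_def M_def)
  have "A / B = sqrt b / sqrt a"
    using arg_cong[OF y1, of exp] pos by (simp add: A_def B_def exp_diff)
  then have AB: "sqrt a * A = sqrt b * B"
    using pos gt by (simp add: field_simps)
  have "M / N = sqrt e / sqrt P"
    using arg_cong[OF y2, of exp] pos P by (simp add: M_def N_def exp_diff)
  then have MN: "sqrt P * M = sqrt e * N"
    using pos gt P by (simp add: field_simps)
  have ABM: "A * B = M ^ 2"
    using \<eta>_real[of y] by (simp add: A_def B_def M_def exp_double flip: exp_add)
  have "\<bar>c\<bar> * (M * N) \<le> a * A ^ 2 + b * B ^ 2 + e * N ^ 2"
    using bound[of y]
    by (simp add: A_def B_def M_def N_def exp_double real_exponent_add inner_add_left exp_add)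
  also have "a * A ^ 2 + b * B ^ 2 = (sqrt a * A) ^ 2 + (sqrt b * B) ^ 2"
    using pos by (simp add: power_mult_distrib)
  also have "\<dots> = 2 * (sqrt a * A) * (sqrt b * B)"
    by (simp add: AB power2_eq_square)
  also have "\<dots> = P * M ^ 2" by (simp add: P_def ABM[symmetric])
  also have "\<dots> + e * N ^ 2 = (sqrt P * M) ^ 2 + (sqrt e * N) ^ 2"
    using pos P by (simp add: power_mult_distrib)
  also have "\<dots> = 2 * (sqrt P * M) * (sqrt e * N)"
    by (simp add: MN power2_eq_square)
  also have "\<dots> = (2 * sqrt P * sqrt e) * (M * N)" by simp
  finally have "\<bar>c\<bar> \<le> 2 * sqrt P * sqrt e"
    using gt by simp
  then have "\<bar>c\<bar> ^ 2 \<le> (2 * sqrt P * sqrt e) ^ 2"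
    by (intro power_mono) auto
  then have disc: "c ^ 2 \<le> 4 * P * e"
    using pos P by (simp add: power_mult_distrib)
  \<comment> \<open>The coefficient of x^(2\<eta>) left over after completing the square in
    x^\<gamma>3.\<close>
  define R where "R = P - c ^ 2 / (4 * e)"
  have R: "R \<ge> 0" using disc pos by (simp add: R_def field_simps)
  define q1 where "q1 = Poly_Mapping.single \<gamma>1 (sqrt a) - Poly_Mapping.single \<gamma>2 (sqrt b)"
  define q2 where "q2 = Poly_Mapping.single \<gamma>3 (sqrt e) + Poly_Mapping.single \<eta> (c / (2 * sqrt e))"
  define q3 where "q3 = Poly_Mapping.single \<eta> (sqrt R)"
  have "2 * (\<Sum>i\<in>UNIV. \<eta> $ i) = 2 * d"
    using arg_cong[OF \<eta>, of "\<lambda>\<alpha>. \<Sum>i\<in>UNIV. \<alpha> $ i"] sums by (simp add: sum.distrib)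
  then have "(\<Sum>i\<in>UNIV. \<eta> $ i) = d" by simp
  then have "q1 \<in> forms d" "q2 \<in> forms d" "q3 \<in> forms d"
    by (auto simp: q1_def q2_def q3_def sums intro!: forms_add forms_diff forms_single)
  then have "q1 ^ 2 + q2 ^ 2 + q3 ^ 2 \<in> sos_forms (2 * d)"
    by (intro sos_forms_add sos_forms_square)
  also have "q1 ^ 2 + q2 ^ 2 + q3 ^ 2 = Poly_Mapping.single (\<gamma>1 + \<gamma>1) a
    + Poly_Mapping.single (\<gamma>2 + \<gamma>2) b
    + Poly_Mapping.single (\<gamma>3 + \<gamma>3) e + Poly_Mapping.single (\<eta> + \<gamma>3) c" (is "_ = ?f")
  proof (rule poly_mapping_eqI_expv)
    fix y :: "real ^ 'n"
    define A B N M where "A = mon (expv y) \<gamma>1" and "B = mon (expv y) \<gamma>2"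
      and "N = mon (expv y) \<gamma>3" and "M = mon (expv y) \<eta>"
    have AB: "A * B = M * M"
      using arg_cong[OF \<eta>, of "mon (expv y)"] by (simp add: A_def B_def M_def mon_add)
    have sq: "sqrt a * sqrt a = a" "sqrt b * sqrt b = b" "sqrt e * sqrt e = e" "sqrt R * sqrt R = R"
      using pos R by auto
    have "peval (q1 ^ 2 + q2 ^ 2 + q3 ^ 2) (expv y) =
      (sqrt a * A - sqrt b * B) ^ 2 + (sqrt e * N + c / (2 * sqrt e) * M) ^ 2 + (sqrt R * M) ^ 2"
      by (simp add: q1_def q2_def q3_def A_def B_def N_def M_def)
    also have "(sqrt a * A - sqrt b * B) ^ 2 = a * (A * A) + b * (B * B) - P * (A * B)"
      unfolding P_def by (subst sq(1)[symmetric], subst sq(2)[symmetric])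
        (simp add: power2_eq_square algebra_simps)
    also have "(sqrt e * N + c / (2 * sqrt e) * M) ^ 2 =
      (sqrt e * sqrt e) * (N * N) + c * (M * N) + c\<^sup>2 / (4 * (sqrt e * sqrt e)) * (M * M)"
      using pos by (simp add: power2_eq_square field_simps del: real_sqrt_mult_self)
    also have "(sqrt R * M) ^ 2 = (sqrt R * sqrt R) * (M * M)"
      by (simp add: power2_eq_square del: real_sqrt_mult_self)
    finally show "peval (q1 ^ 2 + q2 ^ 2 + q3 ^ 2) (expv y) = peval ?f (expv y)"
      unfolding AB sq
      by (simp add: R_def mon_add A_def B_def N_def M_def algebra_simps)
  qed
  finally show ?thesis .
qed

section \<open>The Hilbert cases\<close>

text \<open>A polytope is the convex hull of its extreme points, and in a circuit these come from
  the square support.\<close>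

lemma circuit_newton_polytope:
  assumes "circuit k f"
  shows "newton_polytope f = convex hull (real_exponent ` square_support f)"
proof -
  have "newton_polytope f = convex hull newton_vertices f"
    unfolding newton_polytope_def newton_vertices_def
    by (rule Krein_Milman_polytope) simp
  then show ?thesis using assms by (simp add: circuit_def)
qed

lemma finite_square_support [simp]: "finite (square_support f)"
  by (simp add: square_support_def)

lemma sum_real_exponent_image:
  "(\<Sum>v\<in>real_exponent ` S. g v) = (\<Sum>\<alpha>\<in>S. g (real_exponent \<alpha>))"
  by (rule sum.reindex_cong[of real_exponent]) (auto simp: inj_on_def)

text \<open>Since \<open>real_exponent\<close> is injective, weights on exponents transport to
  weights on points. This is the form in which an explicit affine relation, given coordinate by
  coordinate, can be refuted.\<close>

lemma circuit_affine_independent: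
  assumes "circuit k f" "sum U (square_support f) = (0::real)"
    and "\<And>i. (\<Sum>\<alpha>\<in>square_support f. U \<alpha> * real (\<alpha> $ i)) = 0"
    and "\<alpha> \<in> square_support f"
  shows "U \<alpha> = 0"
proof (rule ccontr)
  assume nz: "U \<alpha> \<noteq> 0"
  define U' where "U' v = U (the_inv real_exponent v)" for v :: "real ^ 'a"
  have U': "U' (real_exponent \<beta>) = U \<beta>" for \<beta>
    by (simp add: U'_def the_inv_f_f inj_real_exponent)
  let ?V = "real_exponent ` square_support f"
  have "affine_dependent ?V"
    unfolding affine_dependent_explicit_finite[OF finite_imageI[OF finite_square_support]]
  proof (intro exI conjI)
    show "sum U' ?V = 0" using assms(2) by (simp add: sum_real_exponent_image U')
    show "\<exists>v\<in>?V. U' v \<noteq> 0" using assms(4) nz by (auto simp: U')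
    show "(\<Sum>v\<in>?V. U' v *\<^sub>R v) = 0"
      using assms(3) by (simp add: sum_real_exponent_image U' vec_eq_iff)
  qed
  then show False using assms(1) by (simp add: circuit_def)
qed

text \<open>The relative interior of a simplex consists of the points whose barycentric coordinates
  are all positive.\<close>

lemma circuit_inner_barycentric:
  assumes "circuit k f" "inner_support f = {\<beta>}"
  obtains u where "\<And>\<alpha>. \<alpha> \<in> square_support f \<Longrightarrow> 0 < u \<alpha>" "sum u (square_support f) = 1"
    "\<And>i. real (\<beta> $ i) = (\<Sum>\<alpha>\<in>square_support f. u \<alpha> * real (\<alpha> $ i))"
proof -
  let ?V = "real_exponent ` square_support f"
  have "real_exponent \<beta> \<in> rel_interior (convex hull ?V)" "\<not> affine_dependent ?V"
    using assms circuit_newton_polytope[OF assms(1)] by (auto simp: circuit_def)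
  then obtain u where u: "\<forall>x\<in>?V. 0 < u x" "sum u ?V = 1"
    "(\<Sum>x\<in>?V. u x *\<^sub>R x) = real_exponent \<beta>"
    by (auto simp: rel_interior_convex_hull_explicit)
  show ?thesis
  proof (rule that[of "u \<circ> real_exponent"])
    show "real (\<beta> $ i) = (\<Sum>\<alpha>\<in>square_support f. (u \<circ> real_exponent) \<alpha> * real (\<alpha> $ i))" for i
      using arg_cong[OF u(3), of "\<lambda>v. v $ i"] by (simp add: sum_real_exponent_image)
  qed (use u in \<open>auto simp: sum_real_exponent_image\<close>)
qed

text \<open>The vertices are affinely independent and lie on the hyperplane of total degree k, which
  has dimension n - 1. For two variables this leaves at most a segment.\<close>

lemma card_square_support_le:
  fixes f :: "'n::finite poly_n"
  assumes "circuit k f"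
  shows "card (square_support f) \<le> CARD('n)"
proof -
  let ?V = "real_exponent ` square_support f"
  define one :: "real ^ 'n" where "one = (\<chi> i. 1)"
  have "one \<bullet> real_exponent \<alpha> = real k" if "\<alpha> \<in> square_support f" for \<alpha>
  proof -
    have "(\<Sum>i\<in>UNIV. \<alpha> $ i) = k" using that assms
      by (auto simp: circuit_def forms_def square_support_def)
    then show ?thesis by (simp add: one_def inner_vec_def flip: of_nat_sum)
  qed
  then have "?V \<subseteq> {x. one \<bullet> x = real k}" by auto
  then have "aff_dim ?V \<le> aff_dim {x. one \<bullet> x = real k}" by (rule aff_dim_subset)
  also have "\<dots> = int CARD('n) - 1"
    by (subst aff_dim_hyperplane) (auto simp: one_def vec_eq_iff of_nat_diff)
  finally have "aff_dim ?V \<le> int CARD('n) - 1" .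
  moreover have "aff_dim ?V = int (card ?V) - 1"
    using assms by (auto simp: circuit_def affine_independent_iff_card)
  moreover have "card ?V = card (square_support f)"
    by (rule card_image) (auto simp: inj_on_def)
  ultimately show ?thesis by simp
qed

lemma square_support_even: "\<alpha> \<in> square_support f \<Longrightarrow> even (\<alpha> $ i)"
  and square_support_pos: "\<alpha> \<in> square_support f \<Longrightarrow> Poly_Mapping.lookup f \<alpha> > 0"
  by (auto simp: square_support_def)

lemma keys_eq_supports: "Poly_Mapping.keys f = square_support f \<union> inner_support f"
  by (auto simp: inner_support_def square_support_def)

lemma inner_notin_square_support: "inner_support f = {\<beta>} \<Longrightarrow> \<beta> \<notin> square_support f"
  by (auto simp: inner_support_def)

lemma peval_square_inner:
  assumes "inner_support f = {\<beta>}"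
  shows "peval f x = (\<Sum>\<alpha>\<in>square_support f. Poly_Mapping.lookup f \<alpha> * mon x \<alpha>)
    + Poly_Mapping.lookup f \<beta> * mon x \<beta>"
  using assms inner_notin_square_support[OF assms] by (simp add: peval_alt keys_eq_supports)

text \<open>
  If the inner coefficient is positive, some entry of \<open>\<beta>\<close> is odd, and flipping the sign of that
  coordinate only changes the sign of the inner term.
\<close>

lemma nonneg_circuit_abs_bound:
  assumes inner: "inner_support f = {\<beta>}" and nonneg: "\<And>x. peval f x \<ge> 0"
  shows "\<bar>Poly_Mapping.lookup f \<beta>\<bar> * exp (real_exponent \<beta> \<bullet> y) \<le>
    (\<Sum>\<alpha>\<in>square_support f. Poly_Mapping.lookup f \<alpha> * exp (real_exponent \<alpha> \<bullet> y))"
proof (cases "Poly_Mapping.lookup f \<beta> \<le> 0")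
  case True
  then show ?thesis
    using nonneg[of "expv y"] by (simp add: peval_square_inner[OF inner] mon_expv)
next
  case False
  have "\<beta> \<in> Poly_Mapping.keys f" "\<beta> \<notin> square_support f"
    using inner by (auto simp: inner_support_def)
  with False obtain i where i: "odd (\<beta> $ i)" by (auto simp: square_support_def)
  define s :: "real ^ 'a" where "s = (\<chi> j. if j = i then -1 else 1)"
  have s: "mon s \<alpha> = (- 1) ^ (\<alpha> $ i)" for \<alpha>
  proof -
    have "mon s \<alpha> = (\<Prod>j\<in>UNIV. if j = i then (- 1) ^ (\<alpha> $ i) else 1)"
      unfolding mon_def s_def by (rule prod.cong) auto
    then show ?thesis by simp
  qed
  have "mon s \<alpha> = 1" if "\<alpha> \<in> square_support f" for \<alpha>
    using square_support_even[OF that, of i] by (simp add: s)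
  then have "peval f (\<chi> j. s $ j * expv y $ j) =
    (\<Sum>\<alpha>\<in>square_support f. Poly_Mapping.lookup f \<alpha> * exp (real_exponent \<alpha> \<bullet> y))
    - Poly_Mapping.lookup f \<beta> * exp (real_exponent \<beta> \<bullet> y)"
    using i by (simp add: peval_square_inner[OF inner] mon_mult mon_expv s[of \<beta>])
  then show ?thesis using nonneg[of "\<chi> j. s $ j * expv y $ j"] False by simp
qed

definition half :: "nat ^ 'n \<Rightarrow> nat ^ 'n::finite" where
  "half \<alpha> = (\<chi> i. \<alpha> $ i div 2)"

lemma half_add_half: "(\<And>i. even (\<alpha> $ i)) \<Longrightarrow> half \<alpha> + half \<alpha> = \<alpha>"
  by (simp add: vec_eq_iff half_def flip: mult_2)

lemma sum_half:
  assumes "\<And>i. even (\<alpha> $ i)" "(\<Sum>i\<in>UNIV. \<alpha> $ i) = 2 * d"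
  shows "(\<Sum>i\<in>UNIV. half \<alpha> $ i) = d"
proof -
  have "(\<Sum>i\<in>UNIV. (half \<alpha> + half \<alpha>) $ i) = 2 * d"
    using assms half_add_half[of \<alpha>] by simp
  then show ?thesis by (simp add: sum.distrib)
qed

lemma real_half: "(\<And>i. even (\<alpha> $ i)) \<Longrightarrow> 2 * (real_exponent (half \<alpha>) \<bullet> y) = real_exponent \<alpha> \<bullet> y"
  using half_add_half[of \<alpha>] by (metis inner_add_left mult_2 real_exponent_add)

lemma monomial_square_sos:
  assumes "\<And>i. even (\<alpha> $ i)" "c \<ge> 0" "(\<Sum>i\<in>UNIV. \<alpha> $ i) = 2 * d"
  shows "Poly_Mapping.single \<alpha> c \<in> sos_forms (2 * d)"
proof -
  have "Poly_Mapping.single \<alpha> c = Poly_Mapping.single (half \<alpha>) (sqrt c) ^ 2"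
    using assms by (simp add: power2_eq_square mult_single half_add_half)
  moreover have "Poly_Mapping.single (half \<alpha>) (sqrt c) \<in> forms d"
    using assms by (intro forms_single sum_half)
  ultimately show ?thesis using sos_forms_square by metis
qed

lemma circuit_sum_nth:
  "circuit k f \<Longrightarrow> \<alpha> \<in> Poly_Mapping.keys f \<Longrightarrow> (\<Sum>i\<in>UNIV. \<alpha> $ i) = k"
  by (auto simp: circuit_def forms_def)

lemma circuit_no_inner_sos:
  assumes "circuit (2 * d) f" "inner_support f = {}"
  shows "f \<in> sos_forms (2 * d)"
proof -
  have "f = (\<Sum>\<alpha>\<in>square_support f. Poly_Mapping.single \<alpha> (Poly_Mapping.lookup f \<alpha>))"
    using assms(2) by (intro poly_mapping_sum_singles) (auto simp: keys_eq_supports)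
  also have "\<dots> \<in> sos_forms (2 * d)"
    by (intro sos_forms_sum monomial_square_sos circuit_sum_nth[OF assms(1)])
      (auto simp: keys_eq_supports square_support_even dest: square_support_pos)
  finally show ?thesis .
qed

lemma inner_circuit_expand:
  assumes "inner_support f = {\<beta>}"
  shows "f = (\<Sum>\<alpha>\<in>square_support f. Poly_Mapping.single \<alpha> (Poly_Mapping.lookup f \<alpha>))
    + Poly_Mapping.single \<beta> (Poly_Mapping.lookup f \<beta>)"
proof -
  have "f = (\<Sum>\<alpha>\<in>insert \<beta> (square_support f). Poly_Mapping.single \<alpha> (Poly_Mapping.lookup f \<alpha>))"
    using assms by (intro poly_mapping_sum_singles) (auto simp: keys_eq_supports)
  then show ?thesis using inner_notin_square_support[OF assms] by (simp add: add.commute)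
qed

section \<open>Circuits with at most two vertices\<close>

text \<open>An inner exponent forces exactly two vertices: weights summing to 1 need at least one,
  and with a single vertex \<beta> would coincide with it. The segment case then applies to the
  halved vertices.\<close>

lemma nonneg_circuit_card_le_2_sos:
  assumes f: "nonneg_circuit (2 * d) f" and card: "card (square_support f) \<le> 2"
  shows "f \<in> sos_forms (2 * d)"
proof (cases "inner_support f = {}")
  case True
  then show ?thesis using f circuit_no_inner_sos by (auto simp: nonneg_circuit_def)
next
  case False
  have circ: "circuit (2 * d) f" using f by (simp add: nonneg_circuit_def)
  with False obtain \<beta> where inner: "inner_support f = {\<beta>}" by (auto simp: circuit_def)
  let ?S = "square_support f" and ?c = "Poly_Mapping.lookup f"
  obtain u where u: "\<And>\<alpha>. \<alpha> \<in> ?S \<Longrightarrow> 0 < u \<alpha>" "sum u ?S = 1"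
    "\<And>i. real (\<beta> $ i) = (\<Sum>\<alpha>\<in>?S. u \<alpha> * real (\<alpha> $ i))"
    using circuit_inner_barycentric[OF circ inner] by blast
  have "card ?S \<noteq> 0" using u(2) by auto
  moreover have "card ?S \<noteq> 1"
  proof
    assume "card ?S = 1"
    then obtain \<alpha> where "?S = {\<alpha>}" by (auto simp: card_1_singleton_iff)
    then have "\<beta> = \<alpha>" using u(2,3) by (simp add: vec_eq_iff)
    then show False using inner_notin_square_support[OF inner] \<open>?S = {\<alpha>}\<close> by simp
  qed
  ultimately have "card ?S = 2" using card by linarith
  then obtain \<alpha>1 \<alpha>2 where S: "?S = {\<alpha>1, \<alpha>2}" and ne: "\<alpha>1 \<noteq> \<alpha>2" by (auto simp: card_2_iff)
  have even: "\<And>i. even (\<alpha>1 $ i)" "\<And>i. even (\<alpha>2 $ i)"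
    using S square_support_even[of _ f] by auto
  have pos: "?c \<alpha>1 > 0" "?c \<alpha>2 > 0" using S square_support_pos[of _ f] by auto
  have sums: "(\<Sum>i\<in>UNIV. \<alpha>1 $ i) = 2 * d" "(\<Sum>i\<in>UNIV. \<alpha>2 $ i) = 2 * d"
    using S circuit_sum_nth[OF circ] by (auto simp: keys_eq_supports)
  have u1: "u \<alpha>1 = 1 - u \<alpha>2" using u(2) S ne by simp
  note h = half_add_half[OF even(1)] half_add_half[OF even(2)]
  have "Poly_Mapping.single (half \<alpha>1 + half \<alpha>1) (?c \<alpha>1) + Poly_Mapping.single (half \<alpha>2 + half \<alpha>2) (?c \<alpha>2)
    + Poly_Mapping.single \<beta> (?c \<beta>) \<in> sos_forms (2 * d)"
  proof (rule segment_circuit_sos)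
    show "half \<alpha>1 \<noteq> half \<alpha>2" using h ne by metis
    show "0 < u \<alpha>2" "u \<alpha>2 < 1" using u(1)[of \<alpha>1] u(1)[of \<alpha>2] S u1 by auto
    show "real (\<beta> $ i) = (1 - u \<alpha>2) * (2 * real (half \<alpha>1 $ i)) + u \<alpha>2 * (2 * real (half \<alpha>2 $ i))" for i
    proof -
      have "2 * real (half \<alpha>1 $ i) = real (\<alpha>1 $ i)" "2 * real (half \<alpha>2 $ i) = real (\<alpha>2 $ i)"
        using even[of i] by (auto simp: half_def elim!: evenE)
      then show ?thesis using u(3)[of i] S ne u1 by simp
    qed
    show "\<bar>?c \<beta>\<bar> * exp (real_exponent \<beta> \<bullet> y) \<le>
      ?c \<alpha>1 * exp (2 * (real_exponent (half \<alpha>1) \<bullet> y)) + ?c \<alpha>2 * exp (2 * (real_exponent (half \<alpha>2) \<bullet> y))" for y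
      using nonneg_circuit_abs_bound[OF inner, of y] f S ne
      by (simp add: nonneg_circuit_def real_half[OF even(1)] real_half[OF even(2)])
  qed (use sum_half even sums pos in auto)
  then show ?thesis using inner_circuit_expand[OF inner] S ne unfolding h by simp
qed

text \<open>An even exponent of degree 2 has no room for two nonzero entries.\<close>

lemma square_support_quadratic:
  assumes "circuit 2 f" "\<alpha> \<in> square_support f"
  obtains i where "\<alpha> = axis i 2"
proof -
  have sum: "(\<Sum>i\<in>UNIV. \<alpha> $ i) = 2"
    using circuit_sum_nth[OF assms(1)] assms(2) by (auto simp: keys_eq_supports)
  then obtain i where i: "\<alpha> $ i \<noteq> 0" by (metis sum.neutral zero_neq_numeral)
  then have ge: "\<alpha> $ i \<ge> 2" using square_support_even[OF assms(2), of i] by (auto elim!: evenE)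
  have "(\<Sum>j\<in>UNIV. \<alpha> $ j) = \<alpha> $ i + (\<Sum>j\<in>UNIV - {i}. \<alpha> $ j)" by (simp add: sum.remove)
  then have "\<alpha> $ i = 2" "(\<Sum>j\<in>UNIV - {i}. \<alpha> $ j) = 0" using sum ge by linarith+
  then have "\<alpha> = axis i 2" by (auto simp: vec_eq_iff axis_def)
  then show ?thesis by (rule that)
qed

text \<open>A vertex 2e_i enters \<beta> with positive weight, so the i-th entry of \<beta> is at
  least 1; since \<beta> has total degree 2, at most two indices i occur.\<close>

lemma card_square_support_quadratic:
  assumes circ: "circuit 2 f" and inner: "inner_support f = {\<beta>}"
  shows "card (square_support f) \<le> 2"
proof -
  let ?S = "square_support f"
  obtain u where u: "\<And>\<alpha>. \<alpha> \<in> ?S \<Longrightarrow> 0 < u \<alpha>" "sum u ?S = 1"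
    "\<And>i. real (\<beta> $ i) = (\<Sum>\<alpha>\<in>?S. u \<alpha> * real (\<alpha> $ i))"
    by (rule circuit_inner_barycentric[OF circ inner]) blast
  have "\<forall>\<alpha>\<in>?S. \<exists>i. \<alpha> = axis i 2" using square_support_quadratic[OF circ] by blast
  then obtain g where g: "\<And>\<alpha>. \<alpha> \<in> ?S \<Longrightarrow> \<alpha> = axis (g \<alpha>) 2" by metis
  have "card ?S = card (g ` ?S)"
    by (rule card_image[symmetric]) (metis g inj_onI)
  also have "\<dots> = (\<Sum>i\<in>g ` ?S. 1)" by simp
  also have "\<dots> \<le> (\<Sum>i\<in>g ` ?S. \<beta> $ i)"
  proof (intro sum_mono)
    fix i assume "i \<in> g ` ?S"
    then obtain \<alpha> where \<alpha>: "\<alpha> \<in> ?S" "i = g \<alpha>" by auto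
    have "0 < u \<alpha> * real (\<alpha> $ i)"
      using u(1)[OF \<alpha>(1)] arg_cong[OF g[OF \<alpha>(1)], of "\<lambda>v. v $ i"] \<alpha>(2) by (simp add: axis_def)
    also have "\<dots> \<le> (\<Sum>\<alpha>\<in>?S. u \<alpha> * real (\<alpha> $ i))"
      using u(1) \<alpha>(1) by (intro member_le_sum) (auto intro!: mult_nonneg_nonneg intro: less_imp_le)
    finally show "1 \<le> \<beta> $ i" using u(3)[of i] by simp
  qed
  also have "\<dots> \<le> (\<Sum>i\<in>UNIV. \<beta> $ i)" by (intro sum_mono2) auto
  also have "\<dots> = 2" using circuit_sum_nth[OF circ] inner by (simp add: keys_eq_supports)
  finally show ?thesis .
qed

text \<open>Transfers \<open>triangle_circuit_sos\<close> to the halved vertices: \<eta> =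
  \<alpha>1/4 + \<alpha>2/4 is the midpoint of the first two halves.\<close>

lemma nonneg_triangle_circuit_sos:
  assumes f: "nonneg_circuit (2 * d) f" and inner: "inner_support f = {\<beta>}"
    and S: "square_support f = {\<alpha>1, \<alpha>2, \<alpha>3}"
    and ne: "\<alpha>1 \<noteq> \<alpha>2" "\<alpha>1 \<noteq> \<alpha>3" "\<alpha>2 \<noteq> \<alpha>3"
    and \<eta>: "half \<alpha>1 + half \<alpha>2 = \<eta> + \<eta>" "\<beta> = \<eta> + half \<alpha>3"
    and indep: "\<And>s t. \<exists>y. real_exponent (half \<alpha>1) \<bullet> y - real_exponent (half \<alpha>2) \<bullet> y = s \<and>
      real_exponent \<eta> \<bullet> y - real_exponent (half \<alpha>3) \<bullet> y = t"
  shows "f \<in> sos_forms (2 * d)"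
proof -
  let ?c = "Poly_Mapping.lookup f"
  have circ: "circuit (2 * d) f" using f by (simp add: nonneg_circuit_def)
  have even: "\<And>i. even (\<alpha>1 $ i)" "\<And>i. even (\<alpha>2 $ i)" "\<And>i. even (\<alpha>3 $ i)"
    using S square_support_even[of _ f] by auto
  have pos: "?c \<alpha>1 > 0" "?c \<alpha>2 > 0" "?c \<alpha>3 > 0" using S square_support_pos[of _ f] by auto
  have sums: "(\<Sum>i\<in>UNIV. \<alpha>1 $ i) = 2 * d" "(\<Sum>i\<in>UNIV. \<alpha>2 $ i) = 2 * d"
    "(\<Sum>i\<in>UNIV. \<alpha>3 $ i) = 2 * d"
    using S circuit_sum_nth[OF circ] by (auto simp: keys_eq_supports)
  note h = half_add_half[OF even(1)] half_add_half[OF even(2)] half_add_half[OF even(3)]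
  have "Poly_Mapping.single (half \<alpha>1 + half \<alpha>1) (?c \<alpha>1) + Poly_Mapping.single (half \<alpha>2 + half \<alpha>2) (?c \<alpha>2)
    + Poly_Mapping.single (half \<alpha>3 + half \<alpha>3) (?c \<alpha>3)
    + Poly_Mapping.single (\<eta> + half \<alpha>3) (?c (\<eta> + half \<alpha>3)) \<in> sos_forms (2 * d)"
  proof (rule triangle_circuit_sos[OF \<eta>(1) _ _ _ indep])
    fix y
    show "\<bar>?c (\<eta> + half \<alpha>3)\<bar> * exp (real_exponent (\<eta> + half \<alpha>3) \<bullet> y) \<le>
      ?c \<alpha>1 * exp (2 * (real_exponent (half \<alpha>1) \<bullet> y)) + ?c \<alpha>2 * exp (2 * (real_exponent (half \<alpha>2) \<bullet> y))
      + ?c \<alpha>3 * exp (2 * (real_exponent (half \<alpha>3) \<bullet> y))"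
      using nonneg_circuit_abs_bound[OF inner, of y] f S ne \<eta>(2)
      by (simp add: nonneg_circuit_def real_half[OF even(1)] real_half[OF even(2)] real_half[OF even(3)])
  qed (use sum_half even sums pos in auto)
  then show ?thesis using inner_circuit_expand[OF inner] S ne \<eta>(2) unfolding h by (simp add: add.assoc)
qed

section \<open>Ternary quartics\<close>

context
  fixes i j k :: "'n::finite"
  assumes UNIV3: "UNIV = {i, j, k}" and distinct: "i \<noteq> j" "i \<noteq> k" "j \<noteq> k"
begin

lemma vec3_eq_iff: "x = (y :: 'a ^ 'n) \<longleftrightarrow> x $ i = y $ i \<and> x $ j = y $ j \<and> x $ k = y $ k"
proof -
  have "(\<forall>l. P l) \<longleftrightarrow> P i \<and> P j \<and> P k" for P
    using UNIV3 by (metis UNIV_I empty_iff insert_iff)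
  then show ?thesis by (simp add: vec_eq_iff)
qed

lemma sum3: "(\<Sum>l\<in>(UNIV::'n set). g l) = g i + (g j + (g k :: 'a :: comm_monoid_add))"
  using distinct by (simp add: UNIV3)

lemma axis3:
  "axis i c $ i = c" "axis i c $ j = 0" "axis i c $ k = 0"
  "axis j c $ i = 0" "axis j c $ j = c" "axis j c $ k = 0"
  "axis k c $ i = 0" "axis k c $ j = 0" "axis k c $ k = (c :: 'a :: zero)"
  using distinct by (auto simp: axis_def)

text \<open>Here \<alpha>2 and \<alpha>3 form the pair with a midpoint and \<alpha>1 carries the
  weight 1/2: (2,1,1) = (0,1,1) + (2,0,0).\<close>

lemma simplex_circuit_sos:
  fixes f :: "'n poly_n"
  assumes f: "nonneg_circuit 4 f" and inner: "inner_support f = {\<beta>}"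
    and S: "square_support f = {\<alpha>1, \<alpha>2, \<alpha>3}"
    and \<beta>: "\<beta> $ i = 2" "\<beta> $ j = 1" "\<beta> $ k = 1"
    and \<alpha>: "\<alpha>1 $ i = 4" "\<alpha>1 $ j = 0" "\<alpha>1 $ k = 0"
      "\<alpha>2 $ i = 0" "\<alpha>2 $ j = 4" "\<alpha>2 $ k = 0"
      "\<alpha>3 $ i = 0" "\<alpha>3 $ j = 0" "\<alpha>3 $ k = 4"
  shows "f \<in> sos_forms 4"
proof -
  let ?\<eta> = "axis j 1 + axis k 1 :: nat ^ 'n"
  have "f \<in> sos_forms (2 * 2)"
  proof (rule nonneg_triangle_circuit_sos[OF _ inner, where \<eta> = ?\<eta>])
    show "\<exists>y. real_exponent (half \<alpha>2) \<bullet> y - real_exponent (half \<alpha>3) \<bullet> y = s \<and>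
      real_exponent ?\<eta> \<bullet> y - real_exponent (half \<alpha>1) \<bullet> y = t" for s t
      \<comment> \<open>Solves 2 y_j - 2 y_k = s and y_j + y_k - 2 y_i = t with y_k = 0.\<close>
      by (rule exI[of _ "axis j (s / 2) + axis i ((s / 2 - t) / 2)"])
        (simp add: inner_vec_def sum3 half_def \<alpha> axis3 field_simps)
  qed (use f S \<alpha> \<beta> in \<open>auto simp: vec3_eq_iff half_def axis3\<close>)
  then show ?thesis by simp
qed

text \<open>Now \<alpha>1 and \<alpha>2 form the pair, and the vertex of weight 1/2 is the middle of
  an edge of the full simplex: (2,1,1) = (1,1,0) + (1,0,1).\<close>

lemma edge_vertex_circuit_sos:
  fixes f :: "'n poly_n"
  assumes f: "nonneg_circuit 4 f" and inner: "inner_support f = {\<beta>}"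
    and S: "square_support f = {\<alpha>1, \<alpha>2, \<alpha>3}"
    and \<beta>: "\<beta> $ i = 2" "\<beta> $ j = 1" "\<beta> $ k = 1"
    and \<alpha>: "\<alpha>1 $ i = 4" "\<alpha>1 $ j = 0" "\<alpha>1 $ k = 0"
      "\<alpha>2 $ i = 0" "\<alpha>2 $ j = 4" "\<alpha>2 $ k = 0"
      "\<alpha>3 $ i = 2" "\<alpha>3 $ j = 0" "\<alpha>3 $ k = 2"
  shows "f \<in> sos_forms 4"
proof -
  let ?\<eta> = "axis i 1 + axis j 1 :: nat ^ 'n"
  have "f \<in> sos_forms (2 * 2)"
  proof (rule nonneg_triangle_circuit_sos[OF _ inner S, where \<eta> = ?\<eta>])
    show "\<exists>y. real_exponent (half \<alpha>1) \<bullet> y - real_exponent (half \<alpha>2) \<bullet> y = s \<and>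
      real_exponent ?\<eta> \<bullet> y - real_exponent (half \<alpha>3) \<bullet> y = t" for s t
      \<comment> \<open>Solves 2 y_i - 2 y_j = s and y_j - y_k = t with y_j = 0.\<close>
      by (rule exI[of _ "axis i (s / 2) + axis k (- t)"])
        (simp add: inner_vec_def sum3 half_def \<alpha> axis3)
  qed (use f S \<alpha> \<beta> in \<open>auto simp: vec3_eq_iff half_def axis3\<close>)
  then show ?thesis by simp
qed

text \<open>If \<beta> had i-th entry 0, positivity of the weights would force the same at every
  vertex. With the degree fixed, the three vertices would lie on a line and be affinely
  dependent.\<close>

lemma triangle_circuit_inner_pos:
  fixes f :: "'n poly_n"
  assumes circ: "circuit m f" and inner: "inner_support f = {\<beta>}"
    and card: "card (square_support f) = 3"
  shows "\<beta> $ i > 0"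
proof (rule ccontr)
  assume "\<not> \<beta> $ i > 0"
  then have \<beta>: "\<beta> $ i = 0" by simp
  let ?S = "square_support f"
  obtain u where u: "\<And>\<alpha>. \<alpha> \<in> ?S \<Longrightarrow> 0 < u \<alpha>" "sum u ?S = 1"
    "\<And>i. real (\<beta> $ i) = (\<Sum>\<alpha>\<in>?S. u \<alpha> * real (\<alpha> $ i))"
    by (rule circuit_inner_barycentric[OF circ inner]) blast
  obtain p q r where S: "?S = {p, q, r}" and ne: "p \<noteq> q" "p \<noteq> r" "q \<noteq> r"
    using card by (auto simp: card_3_iff)
  have "u \<alpha> * real (\<alpha> $ i) = 0" if "\<alpha> \<in> ?S" for \<alpha>
  proof (rule sum_nonneg_0[of ?S])
    show "(\<Sum>\<alpha>\<in>?S. u \<alpha> * real (\<alpha> $ i)) = 0" using u(3)[of i] \<beta> by simp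
  qed (use u(1) that in \<open>auto intro!: mult_nonneg_nonneg intro: less_imp_le\<close>)
  then have i0: "\<alpha> $ i = 0" if "\<alpha> \<in> ?S" for \<alpha> using u(1) that by fastforce
  have "\<alpha> $ i + (\<alpha> $ j + \<alpha> $ k) = m" if "\<alpha> \<in> ?S" for \<alpha>
    using circuit_sum_nth[OF circ] that unfolding sum3 by (auto simp: keys_eq_supports)
  then have k: "real (\<alpha> $ k) = real m - real (\<alpha> $ j)" if "\<alpha> \<in> ?S" for \<alpha>
    using i0[OF that] that by fastforce
  \<comment> \<open>The affine relation of three collinear points: each weight is a difference of
    the j-th entries of the other two, so that the weights and the weighted j-th entries both sum to
    0.\<close>
  define U :: "nat ^ 'n \<Rightarrow> real" where "U \<alpha> = (if \<alpha> = p then real (q $ j) - real (r $ j)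
    else if \<alpha> = q then real (r $ j) - real (p $ j) else real (p $ j) - real (q $ j))" for \<alpha>
  have U_0: "sum U ?S = 0" using S ne by (simp add: U_def)
  have "U r = 0"
  proof (rule circuit_affine_independent[OF circ])
    show "sum U ?S = 0" by (rule U_0)
    have U_j: "(\<Sum>\<alpha>\<in>?S. U \<alpha> * real (\<alpha> $ j)) = 0"
      using S ne by (simp add: U_def algebra_simps)
    moreover have "(\<Sum>\<alpha>\<in>?S. U \<alpha> * real (\<alpha> $ i)) = 0" by (simp add: i0)
    moreover have "(\<Sum>\<alpha>\<in>?S. U \<alpha> * real (\<alpha> $ k)) = 0"
    proof -
      have "(\<Sum>\<alpha>\<in>?S. U \<alpha> * real (\<alpha> $ k)) = (\<Sum>\<alpha>\<in>?S. real m * U \<alpha> - U \<alpha> * real (\<alpha> $ j))"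
        by (intro sum.cong) (auto simp: k algebra_simps)
      also have "\<dots> = 0"
        using U_0 U_j by (simp add: sum_subtractf flip: sum_distrib_left)
      finally show ?thesis .
    qed
    ultimately show "(\<Sum>\<alpha>\<in>?S. U \<alpha> * real (\<alpha> $ l)) = 0" for l
    proof -
      have "l = i \<or> l = j \<or> l = k" using UNIV3 by auto
      then show ?thesis using \<open>(\<Sum>\<alpha>\<in>?S. U \<alpha> * real (\<alpha> $ i)) = 0\<close> U_j
        \<open>(\<Sum>\<alpha>\<in>?S. U \<alpha> * real (\<alpha> $ k)) = 0\<close> by blast
    qed
  qed (use S in auto)
  then have "p $ j = q $ j" using ne by (simp add: U_def)
  moreover have "p $ i = q $ i" using S i0 by auto
  moreover have "real (p $ k) = real (q $ k)"
    using S k[of p] k[of q] \<open>p $ j = q $ j\<close> by auto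
  ultimately have "p = q" unfolding vec3_eq_iff by simp
  then show False using ne by simp
qed

end

text \<open>The numbers are the j-th and k-th entries of the two vertices other than (4,0,0) when
  \<beta> = (2,1,1). Only five even pairs are possible for each, and linear arithmetic in the
  weights decides every combination. For instance (2,0) with (0,2) would need u2 = u3 = 1/2, against
  u1 > 0.\<close>

lemma ternary_quartic_vertices:
  fixes u1 u2 u3 :: real and y2 z2 y3 z3 :: nat
  assumes u: "u1 > 0" "u2 > 0" "u3 > 0" "u1 + u2 + u3 = 1"
    and even: "even y2" "even z2" "even y3" "even z3"
    and le: "y2 + z2 \<le> 4" "y3 + z3 \<le> 4" "y2 + z2 > 0" "y3 + z3 > 0"
    and eqs: "u2 * real y2 + u3 * real y3 = 1" "u2 * real z2 + u3 * real z3 = 1"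
    and ne: "(y2, z2) \<noteq> (y3, z3)"
  shows "(y2, z2, y3, z3) \<in> {(4,0,0,4), (0,4,4,0), (4,0,0,2), (0,4,2,0), (2,0,0,4), (0,2,4,0)}"
proof -
  have *: "(y, z) \<in> {(4,0), (0,4), (2,0), (0,2), (2,2)}"
    if "even y" "even z" "y + z \<le> 4" "y + z > 0" for y z :: nat
    using that by (elim evenE) (simp, presburger)
  have "(y2, z2) \<in> {(4,0), (0,4), (2,0), (0,2), (2,2)}" "(y3, z3) \<in> {(4,0), (0,4), (2,0), (0,2), (2,2)}"
    using * even le by auto
  then show ?thesis
    using u eqs ne by (elim insertE emptyE; simp; linarith?)
qed

text \<open>For a triangle, the entries of \<beta> are positive and add up to 4, hence are 2, 1, 1
  in some order. This leaves few enough triangles to enumerate.\<close>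

lemma nonneg_circuit_ternary_quartic_sos:
  fixes f :: "'n::finite poly_n"
  assumes n: "CARD('n) = 3" and f: "nonneg_circuit 4 f"
  shows "f \<in> sos_forms 4"
proof (cases "card (square_support f) \<le> 2 \<or> inner_support f = {}")
  case True
  then show ?thesis
    using nonneg_circuit_card_le_2_sos[of 2 f] circuit_no_inner_sos[of 2 f] f
    by (auto simp: nonneg_circuit_def)
next
  case False
  let ?S = "square_support f"
  have circ: "circuit 4 f" using f by (simp add: nonneg_circuit_def)
  with False obtain \<beta> where inner: "inner_support f = {\<beta>}" by (auto simp: circuit_def)
  have card: "card ?S = 3" using False card_square_support_le[OF circ] n by simp
  obtain i' j' k' where ijk': "UNIV = {i', j', k' :: 'n}" "i' \<noteq> j'" "i' \<noteq> k'" "j' \<noteq> k'"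
    using n by (auto simp: card_3_iff)
  have "\<beta> $ i' > 0"
    by (rule triangle_circuit_inner_pos[OF ijk' circ inner card])
  moreover have "\<beta> $ j' > 0"
    by (rule triangle_circuit_inner_pos[of j' i' k', OF _ _ _ _ circ inner card]) (use ijk' in auto)
  moreover have "\<beta> $ k' > 0"
    by (rule triangle_circuit_inner_pos[of k' i' j', OF _ _ _ _ circ inner card]) (use ijk' in auto)
  moreover have "\<beta> $ i' + (\<beta> $ j' + \<beta> $ k') = 4"
    using circuit_sum_nth[OF circ, of \<beta>] inner sum3[OF ijk', of "\<lambda>l. \<beta> $ l"] by (simp add: keys_eq_supports)
  ultimately have "\<beta> $ i' = 2 \<and> \<beta> $ j' = 1 \<and> \<beta> $ k' = 1 \<or> \<beta> $ i' = 1 \<and> \<beta> $ j' = 2 \<and> \<beta> $ k' = 1 \<or>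
    \<beta> $ i' = 1 \<and> \<beta> $ j' = 1 \<and> \<beta> $ k' = 2" by arith
  then obtain i j k where ijk: "UNIV = {i, j, k :: 'n}" "i \<noteq> j" "i \<noteq> k" "j \<noteq> k"
    and \<beta>: "\<beta> $ i = 2" "\<beta> $ j = 1" "\<beta> $ k = 1"
  proof (elim disjE conjE, goal_cases)
    case 1 then show ?case using that[of i' j' k'] ijk' by blast
  next
    case 2 then show ?case using that[of j' i' k'] ijk' by blast
  next
    case 3 then show ?case using that[of k' i' j'] ijk' by blast
  qed
  have ikj: "UNIV = {i, k, j}" "i \<noteq> k" "i \<noteq> j" "k \<noteq> j" using ijk by auto
  obtain u where u: "\<And>\<alpha>. \<alpha> \<in> ?S \<Longrightarrow> 0 < u \<alpha>" "sum u ?S = 1"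
    "\<And>i. real (\<beta> $ i) = (\<Sum>\<alpha>\<in>?S. u \<alpha> * real (\<alpha> $ i))"
    by (rule circuit_inner_barycentric[OF circ inner]) blast
  have sum: "\<alpha> $ i + (\<alpha> $ j + \<alpha> $ k) = 4" if "\<alpha> \<in> ?S" for \<alpha>
    using circuit_sum_nth[OF circ, of \<alpha>] that sum3[OF ijk, of "\<lambda>l. \<alpha> $ l"] by (simp add: keys_eq_supports)
  note eq_iff = vec3_eq_iff[OF ijk]
  \<comment> \<open>Otherwise all vertices have i-th entry at most 2 while the weighted mean is 2,
    so all have exactly 2. Only (2,2,0) and (2,0,2) are then available, too few for a
    triangle.\<close>
  have "\<exists>\<alpha>\<in>?S. \<alpha> $ i = 4"
  proof (rule ccontr)
    assume no4: "\<not> (\<exists>\<alpha>\<in>?S. \<alpha> $ i = 4)"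
    have le2: "\<alpha> $ i \<le> 2" if "\<alpha> \<in> ?S" for \<alpha>
    proof -
      have "\<alpha> $ i \<noteq> 4" "\<alpha> $ i \<le> 4" "even (\<alpha> $ i)"
        using no4 sum[OF that] square_support_even[OF that] that by auto
      then show ?thesis by presburger
    qed
    have "(\<Sum>\<alpha>\<in>?S. u \<alpha> * (2 - real (\<alpha> $ i))) = 2 * sum u ?S - (\<Sum>\<alpha>\<in>?S. u \<alpha> * real (\<alpha> $ i))"
      by (simp add: algebra_simps sum_subtractf sum_distrib_left)
    also have "\<dots> = 0" using u(2) u(3)[of i] \<beta> by simp
    finally have s0: "(\<Sum>\<alpha>\<in>?S. u \<alpha> * (2 - real (\<alpha> $ i))) = 0" .
    have "u \<alpha> * (2 - real (\<alpha> $ i)) = 0" if "\<alpha> \<in> ?S" for \<alpha>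
      using le2 u(1) that by (intro sum_nonneg_0[OF _ _ s0]) (auto intro!: mult_nonneg_nonneg intro: less_imp_le)
    then have i2: "\<alpha> $ i = 2" if "\<alpha> \<in> ?S" for \<alpha> using u(1) that by fastforce
    have "inj_on (\<lambda>\<alpha>. \<alpha> $ j) ?S"
    proof (rule inj_onI)
      fix \<alpha> \<alpha>' assume a: "\<alpha> \<in> ?S" "\<alpha>' \<in> ?S" "\<alpha> $ j = \<alpha>' $ j"
      then show "\<alpha> = \<alpha>'" using sum[OF a(1)] sum[OF a(2)] i2[OF a(1)] i2[OF a(2)] by (simp add: eq_iff)
    qed
    then have "card ?S = card ((\<lambda>\<alpha>. \<alpha> $ j) ` ?S)" by (rule card_image[symmetric])
    also have "\<dots> \<le> card {0, 2 :: nat}"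
    proof (rule card_mono)
      show "(\<lambda>\<alpha>. \<alpha> $ j) ` ?S \<subseteq> {0, 2}"
      proof (rule image_subsetI)
        fix \<alpha> assume a: "\<alpha> \<in> ?S"
        have "even (\<alpha> $ j)" "\<alpha> $ j \<le> 2" using square_support_even[OF a] sum[OF a] i2[OF a] by auto
        then show "\<alpha> $ j \<in> {0, 2}" unfolding insert_iff empty_iff by presburger
      qed
    qed simp
    finally show False using card by simp
  qed
  then obtain \<alpha>1 where \<alpha>1: "\<alpha>1 \<in> ?S" "\<alpha>1 $ i = 4" by blast
  then have \<alpha>1_jk: "\<alpha>1 $ j = 0" "\<alpha>1 $ k = 0" using sum[OF \<alpha>1(1)] by auto
  have "card (?S - {\<alpha>1}) = 2" using card \<alpha>1 by simp
  then obtain \<alpha>2 \<alpha>3 where S': "?S - {\<alpha>1} = {\<alpha>2, \<alpha>3}" and ne: "\<alpha>2 \<noteq> \<alpha>3" by (auto simp: card_2_iff)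
  then have S: "?S = {\<alpha>1, \<alpha>2, \<alpha>3}" and ne1: "\<alpha>1 \<noteq> \<alpha>2" "\<alpha>1 \<noteq> \<alpha>3" using \<alpha>1 by auto
  have S_swap: "?S = {\<alpha>1, \<alpha>3, \<alpha>2}" using S by auto
  have sum2: "\<alpha>2 $ i + (\<alpha>2 $ j + \<alpha>2 $ k) = 4" "\<alpha>3 $ i + (\<alpha>3 $ j + \<alpha>3 $ k) = 4" using S sum by auto
  have even: "\<And>l. even (\<alpha>2 $ l)" "\<And>l. even (\<alpha>3 $ l)" using S square_support_even[of _ f] by auto
  have "(\<alpha>2 $ j, \<alpha>2 $ k, \<alpha>3 $ j, \<alpha>3 $ k) \<in>
    {(4,0,0,4), (0,4,4,0), (4,0,0,2), (0,4,2,0), (2,0,0,4), (0,2,4,0)}"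
  proof (rule ternary_quartic_vertices[of "u \<alpha>1" "u \<alpha>2" "u \<alpha>3"])
    show "u \<alpha>1 > 0" "u \<alpha>2 > 0" "u \<alpha>3 > 0" using S u(1) by auto
    show "u \<alpha>1 + u \<alpha>2 + u \<alpha>3 = 1" using S ne ne1 u(2) by simp
    show "u \<alpha>2 * real (\<alpha>2 $ j) + u \<alpha>3 * real (\<alpha>3 $ j) = 1"
      using u(3)[of j] S ne ne1 \<beta> \<alpha>1_jk by simp
    show "u \<alpha>2 * real (\<alpha>2 $ k) + u \<alpha>3 * real (\<alpha>3 $ k) = 1"
      using u(3)[of k] S ne ne1 \<beta> \<alpha>1_jk by simp
    show "(\<alpha>2 $ j, \<alpha>2 $ k) \<noteq> (\<alpha>3 $ j, \<alpha>3 $ k)"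
      using ne sum2 by (auto simp: eq_iff)
    show "\<alpha>2 $ j + \<alpha>2 $ k > 0" using ne1(1) sum2(1) \<alpha>1(2) \<alpha>1_jk by (auto simp: eq_iff)
    show "\<alpha>3 $ j + \<alpha>3 $ k > 0" using ne1(2) sum2(2) \<alpha>1(2) \<alpha>1_jk by (auto simp: eq_iff)
  qed (use even sum2 in auto)
  then consider "\<alpha>2 $ j = 4" "\<alpha>2 $ k = 0" "\<alpha>3 $ j = 0" "\<alpha>3 $ k = 4"
    | "\<alpha>2 $ j = 0" "\<alpha>2 $ k = 4" "\<alpha>3 $ j = 4" "\<alpha>3 $ k = 0"
    | "\<alpha>2 $ j = 4" "\<alpha>2 $ k = 0" "\<alpha>3 $ j = 0" "\<alpha>3 $ k = 2"
    | "\<alpha>2 $ j = 0" "\<alpha>2 $ k = 4" "\<alpha>3 $ j = 2" "\<alpha>3 $ k = 0"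
    | "\<alpha>2 $ j = 2" "\<alpha>2 $ k = 0" "\<alpha>3 $ j = 0" "\<alpha>3 $ k = 4"
    | "\<alpha>2 $ j = 0" "\<alpha>2 $ k = 2" "\<alpha>3 $ j = 4" "\<alpha>3 $ k = 0" by auto
  then show ?thesis
  \<comment> \<open>The six lists show two shapes only, up to exchanging \<alpha>2 with \<alpha>3
    (\<open>S_swap\<close>) and j with k (\<open>ikj\<close>).\<close>
  proof cases
    case 1
    show ?thesis by (rule simplex_circuit_sos[OF ijk f inner S \<beta>]) (use \<alpha>1 \<alpha>1_jk sum2 1 in auto)
  next
    case 2
    show ?thesis by (rule simplex_circuit_sos[OF ijk f inner S_swap \<beta>]) (use \<alpha>1 \<alpha>1_jk sum2 2 in auto)
  next
    case 3
    show ?thesis by (rule edge_vertex_circuit_sos[OF ijk f inner S \<beta>]) (use \<alpha>1 \<alpha>1_jk sum2 3 in auto)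
  next
    case 4
    show ?thesis by (rule edge_vertex_circuit_sos[OF ikj f inner S \<beta>(1,3,2)])
        (use \<alpha>1 \<alpha>1_jk sum2 4 in auto)
  next
    case 5
    show ?thesis by (rule edge_vertex_circuit_sos[OF ikj f inner S_swap \<beta>(1,3,2)])
        (use \<alpha>1 \<alpha>1_jk sum2 5 in auto)
  next
    case 6
    show ?thesis by (rule edge_vertex_circuit_sos[OF ijk f inner S_swap \<beta>])
        (use \<alpha>1 \<alpha>1_jk sum2 6 in auto)
  qed
qed

lemma hilbert_case_nonneg_circuit_sos:
  fixes f :: "'n::finite poly_n"
  assumes "hilbert_case CARD('n) (2 * d)" and f: "nonneg_circuit (2 * d) f"
  shows "f \<in> sos_forms (2 * d)"
proof -
  have circ: "circuit (2 * d) f" using f by (simp add: nonneg_circuit_def)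
  consider "CARD('n) = 2" | "d = 1" | "CARD('n) = 3" "d = 2"
    using assms(1) by (auto simp: hilbert_case_def)
  then show ?thesis
  proof cases
    case 1
    then show ?thesis
      using card_square_support_le[OF circ] by (intro nonneg_circuit_card_le_2_sos[OF f]) simp
  next
    case 2
    show ?thesis
    proof (cases "inner_support f = {}")
      case False
      then obtain \<beta> where "inner_support f = {\<beta>}" using circ by (auto simp: circuit_def)
      then show ?thesis using circ 2
        by (intro nonneg_circuit_card_le_2_sos[OF f] card_square_support_quadratic) auto
    qed (rule circuit_no_inner_sos[OF circ])
  next
    case 3
    then show ?thesis using nonneg_circuit_ternary_quartic_sos f by force
  qed
qed

lemma hilbert_case_mult_closed:
  assumes "hilbert_case CARD('n::finite) (2 * d)"
  shows "sos_plus_sonc_mult_closed TYPE('n) d"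
  unfolding sos_plus_sonc_mult_closed_def
proof (intro ballI)
  have sos: "f \<in> sos_forms (2 * d)" if "f \<in> sos_plus_sonc (2 * d)" for f :: "'n poly_n"
    using that hilbert_case_nonneg_circuit_sos[OF assms]
    by (auto simp: sos_plus_sonc_def sonc_forms_def intro!: sos_forms_add sos_forms_sum_list)
  fix f g :: "'n poly_n"
  assume "f \<in> sos_plus_sonc (2 * d)" "g \<in> sos_plus_sonc (2 * d)"
  then have "f * g \<in> sos_forms (4 * d)"
    using sos_forms_mult[of f d g d] sos by simp
  then show "f * g \<in> sos_plus_sonc (4 * d)"
    unfolding sos_plus_sonc_def by (auto intro: exI[of _ "f * g"] exI[of _ 0])
qed

section \<open>The non-Hilbert cases\<close>

text \<open>
  Along the curve \<open>t \<mapsto> exp (y + t u)\<close> the two sides grow like \<open>exp (t k)\<close>, where \<open>k\<close> is the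
  maximum of \<open>u\<close> over the respective Newton polytope.
\<close>

lemma newton_polytope_growth:
  fixes r g :: "'n::finite poly_n"
  assumes le: "\<And>x. peval r x ^ 2 \<le> peval g x"
    and g: "\<And>\<alpha>. \<alpha> \<in> Poly_Mapping.keys g \<Longrightarrow> real_exponent \<alpha> \<bullet> u \<le> 2 * D"
    and \<alpha>: "\<alpha> \<in> Poly_Mapping.keys r"
  shows "real_exponent \<alpha> \<bullet> u \<le> D"
proof (rule ccontr)
  assume gt: "\<not> real_exponent \<alpha> \<bullet> u \<le> D"
  define K where "K = Max ((\<lambda>\<alpha>. real_exponent \<alpha> \<bullet> u) ` Poly_Mapping.keys r)"
  have K_ge: "real_exponent \<beta> \<bullet> u \<le> K" if "\<beta> \<in> Poly_Mapping.keys r" for \<beta>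
    using that by (simp add: K_def)
  have "K > D" using gt K_ge[OF \<alpha>] by simp
  have "K \<in> (\<lambda>\<alpha>. real_exponent \<alpha> \<bullet> u) ` Poly_Mapping.keys r"
    unfolding K_def using \<alpha> by (intro Max_in) auto
  then obtain \<mu> where \<mu>: "\<mu> \<in> Poly_Mapping.keys r" "real_exponent \<mu> \<bullet> u = K" by auto
  have lim: "((\<lambda>t. c * exp (s * t)) \<longlongrightarrow> (if s = 0 then c else 0)) at_top" if "s \<le> 0" for c s :: real
  proof (cases "s = 0")
    case False
    then have "filterlim (\<lambda>t. s * t) at_bot at_top"
      using that by (intro filterlim_tendsto_neg_mult_at_bot[OF tendsto_const]) (auto intro: filterlim_ident)
    then have "((\<lambda>t. exp (s * t)) \<longlongrightarrow> 0) at_top"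
      by (rule filterlim_compose[OF exp_at_bot])
    then show ?thesis using False tendsto_mult_right_zero by fastforce
  qed simp
  \<comment> \<open>The face of exponents of r on which u is maximal. Scaled by exp (- K t), r tends
    along the curve to its part on this face, while its square stays below g scaled by exp (- 2 K
    t), which tends to 0 since K > D. So this part vanishes identically, against independence of the
    exponentials.\<close>
  let ?T = "{\<alpha> \<in> Poly_Mapping.keys r. real_exponent \<alpha> \<bullet> u = K}"
  let ?c = "Poly_Mapping.lookup r"
  have "(\<Sum>\<alpha>\<in>?T. ?c \<alpha> * exp (real_exponent \<alpha> \<bullet> y)) = 0" for y
  proof -
    let ?e = "\<lambda>t. \<Sum>\<alpha>\<in>Poly_Mapping.keys r.
      (?c \<alpha> * exp (real_exponent \<alpha> \<bullet> y)) * exp ((real_exponent \<alpha> \<bullet> u - K) * t)"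
    let ?h = "\<lambda>t. \<Sum>\<alpha>\<in>Poly_Mapping.keys g.
      (Poly_Mapping.lookup g \<alpha> * exp (real_exponent \<alpha> \<bullet> y)) * exp ((real_exponent \<alpha> \<bullet> u - 2 * K) * t)"
    have "?e t ^ 2 \<le> ?h t" for t
    proof -
      have "?e t = peval r (expv (y + t *\<^sub>R u)) * exp (- (K * t))"
        unfolding peval_expv sum_distrib_right
        by (intro sum.cong) (simp_all add: inner_add_right algebra_simps flip: exp_add)
      then have "?e t ^ 2 = peval r (expv (y + t *\<^sub>R u)) ^ 2 * exp (- (2 * K * t))"
        by (simp add: power_mult_distrib flip: exp_double)
      also have "\<dots> \<le> peval g (expv (y + t *\<^sub>R u)) * exp (- (2 * K * t))"
        by (intro mult_right_mono le) simp
      also have "\<dots> = ?h t"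
        unfolding peval_expv sum_distrib_right
        by (intro sum.cong) (simp_all add: inner_add_right algebra_simps flip: exp_add)
      finally show ?thesis .
    qed
    moreover have "(?e \<longlongrightarrow> (\<Sum>\<alpha>\<in>Poly_Mapping.keys r.
        if real_exponent \<alpha> \<bullet> u - K = 0 then ?c \<alpha> * exp (real_exponent \<alpha> \<bullet> y) else 0)) at_top"
      by (intro tendsto_sum lim) (use K_ge in simp)
    moreover have "(?h \<longlongrightarrow> (\<Sum>\<alpha>\<in>Poly_Mapping.keys g. if real_exponent \<alpha> \<bullet> u - 2 * K = 0
        then Poly_Mapping.lookup g \<alpha> * exp (real_exponent \<alpha> \<bullet> y) else 0)) at_top"
      by (intro tendsto_sum lim) (use g \<open>K > D\<close> in force)
    moreover have "(\<Sum>\<alpha>\<in>Poly_Mapping.keys g. if real_exponent \<alpha> \<bullet> u - 2 * K = 0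
        then Poly_Mapping.lookup g \<alpha> * exp (real_exponent \<alpha> \<bullet> y) else 0) = 0"
      using g \<open>K > D\<close> by (intro sum.neutral) force
    ultimately have "(\<Sum>\<alpha>\<in>Poly_Mapping.keys r.
        if real_exponent \<alpha> \<bullet> u - K = 0 then ?c \<alpha> * exp (real_exponent \<alpha> \<bullet> y) else 0) ^ 2 \<le> 0"
      by (intro tendsto_le[of at_top ?h _ "\<lambda>t. ?e t ^ 2"] tendsto_power) auto
    then show ?thesis by (simp add: sum.If_cases Int_def)
  qed
  then have "?c \<mu> = 0"
    by (rule exponentials_independent[of ?T, rotated]) (use \<mu> in auto)
  then show False using \<mu> by (simp add: in_keys_iff)
qed

section \<open>An obstruction to being a sum of squares\<close>

text \<open>The coefficient at \<beta> collects the products c_a c_b with a + b = \<beta>; if only a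
  = b occurs, these are squares.\<close>

lemma lookup_square_nonneg:
  fixes r :: "'n::finite poly_n"
  assumes "\<And>a b. a \<in> Poly_Mapping.keys r \<Longrightarrow> b \<in> Poly_Mapping.keys r \<Longrightarrow> a + b = \<beta> \<Longrightarrow> a = b"
  shows "Poly_Mapping.lookup (r ^ 2) \<beta> \<ge> 0"
proof -
  let ?R = "Poly_Mapping.keys r" and ?c = "Poly_Mapping.lookup r"
  have r: "r = (\<Sum>a\<in>?R. Poly_Mapping.single a (?c a))"
    by (rule poly_mapping_sum_singles) auto
  have "r ^ 2 = (\<Sum>a\<in>?R. \<Sum>b\<in>?R. Poly_Mapping.single (a + b) (?c a * ?c b))"
    unfolding power2_eq_square by (subst (1 2) r) (simp only: sum_product mult_single)
  then have "Poly_Mapping.lookup (r ^ 2) \<beta> = (\<Sum>a\<in>?R. \<Sum>b\<in>?R. if a + b = \<beta> then ?c a * ?c b else 0)"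
    by (simp add: lookup_sum lookup_single when_def)
  also have "\<dots> \<ge> 0"
    by (intro sum_nonneg) (metis assms zero_le_square order_refl)
  finally show ?thesis .
qed

text \<open>Every summand r satisfies r^2 \<le> g pointwise. Uniqueness is demanded only of such r,
  so that growth estimates can supply it.\<close>

lemma negative_coefficient_not_sos:
  fixes g :: "'n::finite poly_n"
  assumes neg: "Poly_Mapping.lookup g \<beta> < 0"
    and uniq: "\<And>r a b. (\<And>x. peval r x ^ 2 \<le> peval g x) \<Longrightarrow> a \<in> Poly_Mapping.keys r \<Longrightarrow>
       b \<in> Poly_Mapping.keys r \<Longrightarrow> a + b = \<beta> \<Longrightarrow> a = b"
  shows "g \<noteq> (\<Sum>r\<leftarrow>rs. r ^ 2)"
proof
  assume g: "g = (\<Sum>r\<leftarrow>rs. r ^ 2)"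
  have "Poly_Mapping.lookup (r ^ 2) \<beta> \<ge> 0" if r: "r \<in> set rs" for r
  proof (rule lookup_square_nonneg)
    fix a b assume "a \<in> Poly_Mapping.keys r" "b \<in> Poly_Mapping.keys r" "a + b = \<beta>"
    moreover have "peval r x ^ 2 \<le> peval g x" for x
      unfolding g peval_sum_list by (rule member_le_sum_list) (use r in auto)
    ultimately show "a = b" using uniq by blast
  qed
  then have "Poly_Mapping.lookup (\<Sum>r\<leftarrow>rs. r ^ 2) \<beta> \<ge> 0"
    by (induction rs) (auto simp: lookup_add)
  then show False using neg g by simp
qed

text \<open>For \<beta> the barycentre of \<open>A\<close> this is \<open>card A\<close> times the
  difference between arithmetic and geometric mean, up to absolute values. The Motzkin and Choi-Lam
  forms have this shape.\<close>

definition amgm_form :: "(nat ^ 'n) set \<Rightarrow> nat ^ 'n \<Rightarrow> 'n::finite poly_n" where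
  "amgm_form A \<beta> = (\<Sum>\<alpha>\<in>A. Poly_Mapping.single \<alpha> 1) - Poly_Mapping.single \<beta> (real (card A))"

lemma lookup_amgm_form:
  "finite A \<Longrightarrow> Poly_Mapping.lookup (amgm_form A \<beta>) \<alpha>
    = (if \<alpha> \<in> A then 1 else 0) - (if \<alpha> = \<beta> then real (card A) else 0)"
  by (simp add: amgm_form_def lookup_minus lookup_sum lookup_single when_def)

text \<open>The equal weights 1 / \<open>card A\<close> are positive barycentric coordinates of
  \<beta>, which places it in the relative interior. It adds nothing to the hull of
  \<open>A\<close>, and by affine independence all points of \<open>A\<close> are vertices.\<close>

lemma circuit_amgm_form:
  fixes A :: "(nat ^ 'n::finite) set"
  assumes A: "finite A" "A \<noteq> {}" and \<beta>: "\<beta> \<notin> A"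
    and even: "\<And>\<alpha> i. \<alpha> \<in> A \<Longrightarrow> even (\<alpha> $ i)"
    and deg: "\<And>\<alpha>. \<alpha> \<in> A \<Longrightarrow> (\<Sum>i\<in>UNIV. \<alpha> $ i) = k"
    and bary: "\<And>i. card A * \<beta> $ i = (\<Sum>\<alpha>\<in>A. \<alpha> $ i)"
    and indep: "\<And>(U :: nat ^ 'n \<Rightarrow> real) \<alpha>. sum U A = 0 \<Longrightarrow>
      (\<And>i. (\<Sum>\<alpha>\<in>A. U \<alpha> * real (\<alpha> $ i)) = 0) \<Longrightarrow> \<alpha> \<in> A \<Longrightarrow> U \<alpha> = 0"
  shows "circuit k (amgm_form A \<beta>)"
proof -
  let ?f = "amgm_form A \<beta>" and ?V = "real_exponent ` A"
  have card: "card A > 0" using A by (simp add: card_gt_0_iff)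
  have keys: "Poly_Mapping.keys ?f = insert \<beta> A"
    using A card \<beta> by (auto simp: in_keys_iff lookup_amgm_form split: if_splits)
  have S: "square_support ?f = A"
    using A card \<beta> even unfolding square_support_def keys by (auto simp: lookup_amgm_form)
  have I: "inner_support ?f = {\<beta>}"
    using \<beta> by (auto simp: inner_support_def keys S)
  have indep': "\<not> affine_dependent ?V"
  proof
    assume "affine_dependent ?V"
    then obtain U where U: "sum U ?V = 0" "\<exists>v\<in>?V. U v \<noteq> 0" "(\<Sum>v\<in>?V. U v *\<^sub>R v) = 0"
      using A by (auto simp: affine_dependent_explicit_finite)
    have "U (real_exponent \<alpha>) = 0" if "\<alpha> \<in> A" for \<alpha>
    proof (rule indep[OF _ _ that])
      show "(\<Sum>\<alpha>\<in>A. U (real_exponent \<alpha>)) = 0" using U(1) by (simp add: sum_real_exponent_image)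
      show "(\<Sum>\<alpha>\<in>A. U (real_exponent \<alpha>) * real (\<alpha> $ i)) = 0" for i
        using arg_cong[OF U(3), of "\<lambda>v. v $ i"] by (simp add: sum_real_exponent_image)
    qed
    then show False using U(2) by auto
  qed
  have bary': "(\<Sum>v\<in>?V. (1 / real (card A)) *\<^sub>R v) = real_exponent \<beta>"
  proof -
    have "(\<Sum>\<alpha>\<in>A. real (\<alpha> $ i)) = real (card A) * real (\<beta> $ i)" for i
      using arg_cong[OF bary[of i], of real] by simp
    then have "(\<Sum>v\<in>?V. (1 / real (card A)) *\<^sub>R v) $ i = real_exponent \<beta> $ i" for i
      using card by (simp add: sum_component sum_real_exponent_image flip: sum_divide_distrib)
    then show ?thesis unfolding vec_eq_iff by blast
  qed
  have card_V: "card ?V = card A" by (rule card_image) (auto simp: inj_on_def)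
  have ri: "real_exponent \<beta> \<in> rel_interior (convex hull ?V)"
    unfolding rel_interior_convex_hull_explicit[OF indep']
    using card card_V by (auto intro!: exI[of _ "\<lambda>_. 1 / real (card A)"] simp: bary')
  have "newton_polytope ?f = convex hull (insert (real_exponent \<beta>) ?V)"
    by (simp add: newton_polytope_def keys)
  also have "\<dots> = convex hull ?V"
    using ri rel_interior_subset by (intro hull_redundant) blast
  finally have New: "newton_polytope ?f = convex hull ?V" .
  have V: "newton_vertices ?f = ?V"
    unfolding newton_vertices_def New
    by (simp add: extreme_point_of_convex_hull_affine_independent[OF indep'])
  have "card A * (\<Sum>i\<in>UNIV. \<beta> $ i) = (\<Sum>i\<in>UNIV. \<Sum>\<alpha>\<in>A. \<alpha> $ i)"
    by (simp add: sum_distrib_left bary)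
  also have "\<dots> = (\<Sum>\<alpha>\<in>A. \<Sum>i\<in>UNIV. \<alpha> $ i)" by (rule sum.swap)
  also have "\<dots> = card A * k" by (simp add: deg)
  finally have "(\<Sum>i\<in>UNIV. \<beta> $ i) = k" using card by simp
  then have "?f \<in> forms k" by (auto simp: forms_def keys deg)
  then show ?thesis
    unfolding circuit_def using S I V New indep' ri by auto
qed

section \<open>Zeros of circuits in logarithmic coordinates\<close>

definition lnabs :: "real ^ 'n \<Rightarrow> real ^ 'n::finite" where
  "lnabs x = (\<chi> i. ln \<bar>x $ i\<bar>)"

lemma abs_mon_lnabs:
  assumes "\<And>i. x $ i \<noteq> 0"
  shows "\<bar>mon x \<alpha>\<bar> = exp (real_exponent \<alpha> \<bullet> lnabs x)"
proof -
  have "expv (lnabs x) = (\<chi> i. \<bar>x $ i\<bar>)"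
    using assms by (simp add: expv_def lnabs_def)
  then show ?thesis
    by (simp add: mon_expv[symmetric]) (simp add: mon_def abs_prod power_abs)
qed

text \<open>
  Normalising the inner term to a constant turns a circuit into a convex function of \<open>ln |x|\<close>;
  two zeros are two minima, between which each of the exponential terms must be constant.
\<close>

lemma nonneg_circuit_zeros:
  assumes h: "nonneg_circuit k h" and inner: "inner_support h = {\<beta>}" and \<alpha>: "\<alpha> \<in> square_support h"
    and x: "\<And>i. x $ i \<noteq> 0" "peval h x = 0" and x': "\<And>i. x' $ i \<noteq> 0" "peval h x' = 0"
  shows "(real_exponent \<alpha> - real_exponent \<beta>) \<bullet> (lnabs x - lnabs x') = 0"
proof -
  let ?S = "square_support h" and ?c = "Poly_Mapping.lookup h"
  let ?e = "\<lambda>\<alpha> y. exp ((real_exponent \<alpha> - real_exponent \<beta>) \<bullet> y)"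
  define G where "G y = (\<Sum>\<alpha>\<in>?S. ?c \<alpha> * ?e \<alpha> y)" for y
  have G: "G y * exp (real_exponent \<beta> \<bullet> y) = (\<Sum>\<alpha>\<in>?S. ?c \<alpha> * exp (real_exponent \<alpha> \<bullet> y))" for y
    by (simp add: G_def sum_distrib_right inner_diff_left exp_diff)
  have G_ge: "\<bar>?c \<beta>\<bar> \<le> G y" for y
  proof -
    have "\<bar>?c \<beta>\<bar> * exp (real_exponent \<beta> \<bullet> y) \<le> G y * exp (real_exponent \<beta> \<bullet> y)"
      unfolding G using h by (intro nonneg_circuit_abs_bound[OF inner]) (simp add: nonneg_circuit_def)
    then show ?thesis by simp
  qed
  \<comment> \<open>At a zero the vertex terms balance the inner term, so \<open>G\<close> attains
    its lower bound there.\<close>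
  have G_le: "G (lnabs x) \<le> \<bar>?c \<beta>\<bar>" if x: "\<And>i. x $ i \<noteq> 0" "peval h x = 0" for x
  proof -
    have "mon x \<alpha> = exp (real_exponent \<alpha> \<bullet> lnabs x)" if "\<alpha> \<in> ?S" for \<alpha>
      using abs_mon_lnabs[OF x(1), of \<alpha>] mon_even_nonneg[of \<alpha> x] square_support_even[OF that] by simp
    then have "G (lnabs x) * exp (real_exponent \<beta> \<bullet> lnabs x) = - (?c \<beta> * mon x \<beta>)"
      using x(2) by (simp add: G peval_square_inner[OF inner])
    also have "\<dots> \<le> \<bar>?c \<beta>\<bar> * \<bar>mon x \<beta>\<bar>" by (metis abs_ge_minus_self abs_mult)
    also have "\<dots> = \<bar>?c \<beta>\<bar> * exp (real_exponent \<beta> \<bullet> lnabs x)" by (simp add: abs_mon_lnabs[OF x(1)])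
    finally show ?thesis by simp
  qed
  define y y' where "y = lnabs x" and "y' = lnabs x'"
  let ?m = "(1 / 2) *\<^sub>R (y + y')"
  \<comment> \<open>The convexity defect of the term of \<alpha> at the midpoint. With a and b the
    exponentials at y/2 and \<open>y'\<close>/2 it is a^2 + b^2 - 2ab, hence visibly a
    square.\<close>
  define D where "D \<alpha> = ?c \<alpha> * (?e \<alpha> ((1 / 2) *\<^sub>R y) - ?e \<alpha> ((1 / 2) *\<^sub>R y')) ^ 2" for \<alpha>
  have half: "?e \<alpha> ((1 / 2) *\<^sub>R z) * ?e \<alpha> ((1 / 2) *\<^sub>R z) = ?e \<alpha> z" for \<alpha> z
    by (simp flip: exp_add)
  have sq: "c * (a - b) ^ 2 = c * (a * a) + c * (b * b) - 2 * (c * (a * b))" for a b c :: real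
    by (simp add: power2_eq_square algebra_simps)
  have "D \<alpha> = ?c \<alpha> * ?e \<alpha> y + ?c \<alpha> * ?e \<alpha> y' - 2 * (?c \<alpha> * ?e \<alpha> ?m)" for \<alpha>
  proof -
    have "?e \<alpha> ?m = ?e \<alpha> ((1 / 2) *\<^sub>R y) * ?e \<alpha> ((1 / 2) *\<^sub>R y')"
      by (simp only: scaleR_add_right inner_add_right exp_add)
    moreover have "D \<alpha> = ?c \<alpha> * (?e \<alpha> ((1 / 2) *\<^sub>R y) * ?e \<alpha> ((1 / 2) *\<^sub>R y))
      + ?c \<alpha> * (?e \<alpha> ((1 / 2) *\<^sub>R y') * ?e \<alpha> ((1 / 2) *\<^sub>R y'))
      - 2 * (?c \<alpha> * (?e \<alpha> ((1 / 2) *\<^sub>R y) * ?e \<alpha> ((1 / 2) *\<^sub>R y')))"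
      unfolding D_def by (rule sq)
    ultimately show ?thesis by (simp only: half)
  qed
  then have "sum D ?S = G y + G y' - 2 * G ?m"
    by (simp add: G_def sum.distrib sum_subtractf sum_distrib_left)
  also have "\<dots> \<le> 0"
    using G_le[OF x] G_le[OF x'] G_ge[of ?m] unfolding y_def y'_def by linarith
  finally have "sum D ?S \<le> 0" .
  moreover have D: "D \<alpha> \<ge> 0" if "\<alpha> \<in> ?S" for \<alpha>
    using square_support_pos[OF that] by (simp add: D_def)
  ultimately have "sum D ?S = 0" by (meson antisym sum_nonneg)
  then have "D \<alpha> = 0" using D \<alpha> by (subst (asm) sum_nonneg_eq_0_iff) auto
  then have "(real_exponent \<alpha> - real_exponent \<beta>) \<bullet> y = (real_exponent \<alpha> - real_exponent \<beta>) \<bullet> y'"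
    using square_support_pos[OF \<alpha>] by (simp add: D_def)
  then show ?thesis by (simp add: y_def y'_def inner_diff_right)
qed

lemma sum_axis [simp]: "(\<Sum>l\<in>UNIV. axis i c $ l) = (c :: 'a :: comm_monoid_add)"
  by (simp add: axis_def)

section \<open>Divisibility by a linear form in three variables\<close>

definition linear3 :: "'n \<Rightarrow> 'n \<Rightarrow> 'n \<Rightarrow> 'n::finite poly_n" where
  "linear3 i j k = Poly_Mapping.single (axis i 1) 1 + Poly_Mapping.single (axis j 1) 1
    + Poly_Mapping.single (axis k 1) 1"

lemma peval_linear3 [simp]: "peval (linear3 i j k) x = x $ i + x $ j + x $ k"
  by (simp add: linear3_def)

lemma linear3_forms: "linear3 i j k \<in> forms 1"
  unfolding linear3_def by (intro forms_add forms_single) (simp_all add: axis_def)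

text \<open>The linear form is positive on the positive orthant and can be cancelled pointwise
  there.\<close>

lemma linear3_mult_cancel:
  assumes "linear3 i j k * f = linear3 i j k * g"
  shows "f = g"
proof (rule poly_mapping_eqI_expv)
  fix y
  have "peval (linear3 i j k) (expv y) > 0"
    by (simp add: expv_def add_pos_pos)
  then show "peval f (expv y) = peval g (expv y)"
    using arg_cong[OF assms, of "\<lambda>h. peval h (expv y)"] by simp
qed

text \<open>Repeatedly replace one factor \<open>x\<^sub>i\<close> by \<open>\<ell> - x\<^sub>j - x\<^sub>k\<close>.\<close>

lemma linear3_division:
  fixes q :: "'n::finite poly_n"
  assumes ne: "i \<noteq> j" "i \<noteq> k"
  shows "\<exists>r s. q = linear3 i j k * r + s \<and> (\<forall>\<alpha>\<in>Poly_Mapping.keys s. \<alpha> $ i = 0)"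
proof -
  let ?P = "\<lambda>q. \<exists>r s. q = linear3 i j k * r + s \<and> (\<forall>\<alpha>\<in>Poly_Mapping.keys s. \<alpha> $ i = 0)"
  have add: "?P (q + q')" if P: "?P q" "?P q'" for q q'
  proof -
    obtain r s r' s' where eq: "q = linear3 i j k * r + s" "q' = linear3 i j k * r' + s'"
      and s: "\<forall>\<alpha>\<in>Poly_Mapping.keys s. \<alpha> $ i = 0" "\<forall>\<alpha>\<in>Poly_Mapping.keys s'. \<alpha> $ i = 0"
      using P by blast
    have "q + q' = linear3 i j k * (r + r') + (s + s')"
      unfolding eq by (simp add: algebra_simps)
    moreover have "\<forall>\<alpha>\<in>Poly_Mapping.keys (s + s'). \<alpha> $ i = 0"
      using s Poly_Mapping.keys_add[of s s'] by blast
    ultimately show ?thesis by blast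
  qed
  have single: "?P (Poly_Mapping.single \<alpha> c)" for \<alpha> and c :: real
  proof (induction "\<alpha> $ i" arbitrary: \<alpha> c)
    case 0
    then show ?case by (intro exI[of _ 0] exI[of _ "Poly_Mapping.single \<alpha> c"]) simp
  next
    case (Suc m)
    define \<alpha>' where "\<alpha>' = (\<chi> l. if l = i then m else \<alpha> $ l)"
    have \<alpha>: "\<alpha> = axis i 1 + \<alpha>'" using Suc(2) by (auto simp: \<alpha>'_def vec_eq_iff axis_def)
    have "?P (Poly_Mapping.single (axis j 1 + \<alpha>') (- c))" "?P (Poly_Mapping.single (axis k 1 + \<alpha>') (- c))"
      using ne by (auto intro!: Suc(1) simp: \<alpha>'_def axis_def)
    note jk = add[OF this]
    have "?P (linear3 i j k * Poly_Mapping.single \<alpha>' c)"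
      by (intro exI[of _ "Poly_Mapping.single \<alpha>' c"] exI[of _ 0]) simp
    from add[OF this jk] have "?P (linear3 i j k * Poly_Mapping.single \<alpha>' c +
      (Poly_Mapping.single (axis j 1 + \<alpha>') (- c) + Poly_Mapping.single (axis k 1 + \<alpha>') (- c)))" .
    also have "linear3 i j k * Poly_Mapping.single \<alpha>' c +
      (Poly_Mapping.single (axis j 1 + \<alpha>') (- c) + Poly_Mapping.single (axis k 1 + \<alpha>') (- c))
      = Poly_Mapping.single \<alpha> c"
      by (simp add: linear3_def distrib_right mult_single \<alpha> single_uminus)
    finally show ?case .
  qed
  have sum: "?P (\<Sum>\<alpha>\<in>A. Poly_Mapping.single \<alpha> (Poly_Mapping.lookup q \<alpha>))" if "finite A" for A
    using that
  proof (induction A)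
    case empty
    then show ?case by (intro exI[of _ 0]) simp
  next
    case (insert \<alpha> A)
    then show ?case using add[OF single] by simp
  qed
  show ?thesis
    using sum[of "Poly_Mapping.keys q"] poly_mapping_sum_singles[of "Poly_Mapping.keys q" q] by simp
qed

text \<open>Division leaves a remainder free of x_i. Any positive values of the other variables
  extend to a zero of the linear form by solving for x_i, so the remainder vanishes on the positive
  orthant and is 0.\<close>

lemma linear3_dvd:
  fixes q :: "'n::finite poly_n"
  assumes ne: "i \<noteq> j" "i \<noteq> k" and zero: "\<And>x. x $ i + x $ j + x $ k = 0 \<Longrightarrow> peval q x = 0"
  obtains r where "q = linear3 i j k * r"
proof -
  obtain r s where q: "q = linear3 i j k * r + s" and s: "\<forall>\<alpha>\<in>Poly_Mapping.keys s. \<alpha> $ i = 0"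
    using linear3_division[OF ne] by blast
  have "s = 0"
  proof (rule poly_mapping_eqI_expv)
    fix y
    define x :: "real ^ 'n" where
      "x = (\<chi> l. if l = i then - (exp (y $ j) + exp (y $ k)) else exp (y $ l))"
    have "peval s x = peval s (expv y)"
      unfolding peval_alt
    proof (rule sum.cong[OF refl])
      fix \<alpha> assume "\<alpha> \<in> Poly_Mapping.keys s"
      then have "\<alpha> $ i = 0" using s by blast
      then have "mon x \<alpha> = mon (expv y) \<alpha>"
        unfolding mon_def by (intro prod.cong) (auto simp: x_def expv_def)
      then show "Poly_Mapping.lookup s \<alpha> * mon x \<alpha> = Poly_Mapping.lookup s \<alpha> * mon (expv y) \<alpha>" by simp
    qed
    moreover have x: "x $ i + x $ j + x $ k = 0" using ne by (simp add: x_def)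
    then have "peval s x = 0" using zero[OF x] by (simp add: q)
    ultimately show "peval s (expv y) = peval 0 (expv y)" by simp
  qed
  then show ?thesis using q that by simp
qed

lemma linear3_power_sos_cancel:
  fixes g :: "'n::finite poly_n"
  assumes ne: "i \<noteq> j" "i \<noteq> k"
    and "(linear3 i j k) ^ (2 * m) * g = (\<Sum>q\<leftarrow>qs. q ^ 2)"
  shows "\<exists>rs. g = (\<Sum>r\<leftarrow>rs. r ^ 2)"
  using assms(3)
proof (induction m arbitrary: qs)
  case (Suc m)
  let ?l = "linear3 i j k"
  have vanish: "peval q x = 0" if q: "q \<in> set qs" and x: "x $ i + x $ j + x $ k = 0" for q x
  proof -
    have "peval q x ^ 2 \<le> peval (\<Sum>q\<leftarrow>qs. q ^ 2) x"
      unfolding peval_sum_list by (rule member_le_sum_list) (use q in auto)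
    also have "\<dots> = 0" unfolding Suc.prems[symmetric] using x by simp
    finally show ?thesis by simp
  qed
  have "\<forall>q\<in>set qs. \<exists>r. q = ?l * r" using linear3_dvd[OF ne] vanish by metis
  then obtain R where R: "\<And>q. q \<in> set qs \<Longrightarrow> q = ?l * R q" by metis
  have "?l * (?l * (?l ^ (2 * m) * g)) = ?l ^ (2 * Suc m) * g"
    by (simp add: mult.assoc)
  also have "\<dots> = (\<Sum>q\<leftarrow>qs. (?l * R q) ^ 2)"
    unfolding Suc.prems using R by (intro arg_cong[of _ _ sum_list] map_cong) auto
  also have "\<dots> = ?l * (?l * (\<Sum>q\<leftarrow>qs. R q ^ 2))"
    by (simp add: power2_eq_square sum_list_const_mult[symmetric] mult_ac)
  finally have "?l ^ (2 * m) * g = (\<Sum>q\<leftarrow>qs. R q ^ 2)"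
    by (blast dest: linear3_mult_cancel)
  then have "?l ^ (2 * m) * g = (\<Sum>q\<leftarrow>map R qs. q ^ 2)" by (simp add: o_def)
  then show ?case by (rule Suc.IH)
qed auto

text \<open>The permutations of (1, 1, -2) give w_i = w_j = w_k, and scaling by 2 makes their sum 0.
  Every other coordinate is unconstrained on the hyperplane and can be varied alone.\<close>

lemma linear3_zeros_span:
  fixes w :: "real ^ 'n::finite"
  assumes d: "i \<noteq> j" "i \<noteq> k" "j \<noteq> k"
    and w: "\<And>x x'. (\<And>l. x $ l \<noteq> 0) \<Longrightarrow> (\<And>l. x' $ l \<noteq> 0) \<Longrightarrow> x $ i + x $ j + x $ k = 0 \<Longrightarrow>
      x' $ i + x' $ j + x' $ k = 0 \<Longrightarrow> w \<bullet> (lnabs x - lnabs x') = 0"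
  shows "w = 0"
proof -
  define pt where "pt a b c = (\<chi> l. if l = i then a else if l = j then b else if l = k then c else 1)"
    for a b c :: real
  have pt_inner: "w \<bullet> lnabs (pt a b c) = w $ i * ln \<bar>a\<bar> + w $ j * ln \<bar>b\<bar> + w $ k * ln \<bar>c\<bar>" for a b c
  proof -
    have "lnabs (pt a b c) = axis i (ln \<bar>a\<bar>) + axis j (ln \<bar>b\<bar>) + axis k (ln \<bar>c\<bar>)"
      using d by (auto simp: lnabs_def pt_def vec_eq_iff axis_def)
    then show ?thesis by (simp add: inner_add_right inner_axis)
  qed
  have pts: "w \<bullet> lnabs (pt a b c) = w \<bullet> lnabs (pt 1 1 (-2))"
    if "a + b + c = 0" "a \<noteq> 0" "b \<noteq> 0" "c \<noteq> 0" for a b c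
    using w[of "pt a b c" "pt 1 1 (-2)"] that d by (simp add: pt_def inner_diff_right)
  have "w $ j * ln 2 = w $ k * ln 2" "w $ i * ln 2 = w $ k * ln 2"
    using pts[of 1 "-2" 1] pts[of "-2" 1 1] by (simp_all add: pt_inner)
  then have eq: "w $ j = w $ k" "w $ i = w $ k" by auto
  \<comment> \<open>The point (2, 2, -4) is twice (1, 1, -2), which adds ln 2 to each of the three
    logarithms.\<close>
  have "ln 4 = ln (2 * 2 :: real)" by simp
  also have "\<dots> = 2 * ln 2" by (subst ln_mult) simp_all
  finally have "w $ i * ln 2 + w $ j * ln 2 + w $ k * ln 2 = 0"
    using pts[of 2 2 "-4"] by (simp add: pt_inner algebra_simps)
  then have k: "w $ k = 0" by (simp add: eq)
  have "w $ m = 0" for m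
  proof (cases "m \<in> {i, j, k}")
    case True
    then show ?thesis using eq k by auto
  next
    case False
    define x where "x = (\<chi> l. if l = m then 2 else pt 1 1 (-2) $ l)"
    have "lnabs x - lnabs (pt 1 1 (-2)) = axis m (ln 2)"
      using False by (auto simp: lnabs_def x_def pt_def vec_eq_iff axis_def)
    moreover have "w \<bullet> (lnabs x - lnabs (pt 1 1 (-2))) = 0"
      using False d by (intro w) (auto simp: x_def pt_def)
    ultimately show ?thesis by (simp add: inner_axis)
  qed
  then show ?thesis by (simp add: vec_eq_iff)
qed

text \<open>With an inner exponent \<beta>, every vertex would have to equal \<beta>, so there is
  none and a single monomial remains. Without one, all terms are positive off the coordinate
  hyperplanes. Neither vanishes at \<open>x0\<close>.\<close>

lemma nonneg_circuit_vanishing_linear3: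
  fixes h :: "'n::finite poly_n"
  assumes d: "i \<noteq> j" "i \<noteq> k" "j \<noteq> k" and h: "nonneg_circuit m h"
    and zero: "\<And>x. x $ i + x $ j + x $ k = 0 \<Longrightarrow> peval h x = 0"
  shows "h = 0"
proof -
  \<comment> \<open>A zero of the linear form with no vanishing coordinate.\<close>
  define x0 :: "real ^ 'n" where "x0 = (\<chi> l. if l = k then - 2 else 1)"
  have x0: "\<And>l. x0 $ l \<noteq> 0" "peval h x0 = 0"
    using d by (auto simp: x0_def intro!: zero)
  have mon0: "mon x0 \<alpha> \<noteq> 0" for \<alpha> by (rule mon_nonzero) (rule x0)
  have S: "square_support h = {}" if inner: "inner_support h = {\<beta>}" for \<beta>
  proof (rule equals0I)
    fix \<alpha> assume \<alpha>: "\<alpha> \<in> square_support h"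
    have "real_exponent \<alpha> - real_exponent \<beta> = 0"
      by (rule linear3_zeros_span[OF d]) (intro nonneg_circuit_zeros[OF h inner \<alpha>] zero)
    then have "\<alpha> = \<beta>" by simp
    then show False using inner_notin_square_support[OF inner] \<alpha> by simp
  qed
  have "Poly_Mapping.keys h = {}"
  proof (cases "inner_support h = {}")
    case True
    then have keys: "Poly_Mapping.keys h = square_support h" by (simp add: keys_eq_supports)
    have "Poly_Mapping.lookup h \<alpha> * mon x0 \<alpha> > 0" if "\<alpha> \<in> square_support h" for \<alpha>
      using square_support_pos[OF that] mon0[of \<alpha>] mon_even_nonneg[of \<alpha> x0]
        square_support_even[OF that] by (simp add: order.strict_iff_order)
    then show ?thesis
      using x0(2) sum_pos[of "square_support h" "\<lambda>\<alpha>. Poly_Mapping.lookup h \<alpha> * mon x0 \<alpha>"]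
      unfolding peval_alt keys by force
  next
    case False
    then obtain \<beta> where inner: "inner_support h = {\<beta>}"
      using h by (auto simp: nonneg_circuit_def circuit_def)
    then have "Poly_Mapping.lookup h \<beta> = 0"
      using x0(2) S[OF inner] mon0 by (simp add: peval_square_inner[OF inner])
    moreover have "\<beta> \<in> Poly_Mapping.keys h" using inner by (auto simp: inner_support_def)
    ultimately show ?thesis by (simp add: in_keys_iff)
  qed
  then show ?thesis by simp
qed

lemma linear3_power_mult_sos_plus_sonc:
  fixes g :: "'n::finite poly_n"
  assumes d: "i \<noteq> j" "i \<noteq> k" "j \<noteq> k" and m: "m > 0"
    and mem: "(linear3 i j k ^ m) ^ 2 * g \<in> sos_plus_sonc n"
  shows "\<exists>rs. g = (\<Sum>r\<leftarrow>rs. r ^ 2)"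
proof -
  let ?f = "(linear3 i j k ^ m) ^ 2 * g"
  obtain qs hs where f: "?f = (\<Sum>q\<leftarrow>qs. q ^ 2) + sum_list hs"
    and hs: "\<And>h. h \<in> set hs \<Longrightarrow> nonneg_circuit n h"
    using mem by (auto simp: sos_plus_sonc_def sos_forms_def sonc_forms_def)
  have "h = 0" if h: "h \<in> set hs" for h
  proof (rule nonneg_circuit_vanishing_linear3[OF d hs[OF h]])
    fix x :: "real ^ 'n" assume x: "x $ i + x $ j + x $ k = 0"
    have nonneg: "peval h x \<ge> 0" if "h \<in> set hs" for h using hs[OF that] by (simp add: nonneg_circuit_def)
    have "peval h x \<le> (\<Sum>h\<leftarrow>hs. peval h x)"
      by (rule member_le_sum_list) (use h nonneg in auto)
    also have "\<dots> \<le> (\<Sum>q\<leftarrow>qs. peval q x ^ 2) + (\<Sum>h\<leftarrow>hs. peval h x)"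
      unfolding le_add_same_cancel2 by (rule sum_list_nonneg) auto
    also have "\<dots> = peval ?f x" unfolding f by (simp add: peval_sum_list o_def)
    also have "\<dots> = 0" using x m by simp
    finally show "peval h x = 0" using nonneg[OF h] by simp
  qed
  then have "sum_list hs = 0" by (induction hs) auto
  then have "linear3 i j k ^ (2 * m) * g = (\<Sum>q\<leftarrow>qs. q ^ 2)"
    using f by (simp add: power_mult[symmetric] mult.commute)
  then show ?thesis by (rule linear3_power_sos_cancel[OF d(1,2)])
qed

section \<open>The Motzkin and Choi-Lam forms\<close>

lemma peval_amgm_form:
  "peval (amgm_form A \<beta>) x = (\<Sum>\<alpha>\<in>A. mon x \<alpha>) - real (card A) * mon x \<beta>"
  by (simp add: amgm_form_def peval_sum)

lemma keys_amgm_form_subset: "finite A \<Longrightarrow> Poly_Mapping.keys (amgm_form A \<beta>) \<subseteq> insert \<beta> A"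
  by (auto simp: in_keys_iff lookup_amgm_form split: if_splits)

lemma amgm_growth:
  assumes "finite A" "\<And>x. peval r x ^ 2 \<le> peval (amgm_form A \<beta>) x"
    and "\<And>\<alpha>. \<alpha> \<in> insert \<beta> A \<Longrightarrow> real_exponent \<alpha> \<bullet> u \<le> 2 * D" "\<alpha> \<in> Poly_Mapping.keys r"
  shows "real_exponent \<alpha> \<bullet> u \<le> D"
proof (rule newton_polytope_growth[OF assms(2) _ assms(4)])
  fix \<gamma> assume "\<gamma> \<in> Poly_Mapping.keys (amgm_form A \<beta>)"
  then show "real_exponent \<gamma> \<bullet> u \<le> 2 * D"
    using keys_amgm_form_subset[OF assms(1)] by (intro assms(3)) blast
qed

lemma inner_one: "real_exponent \<alpha> \<bullet> (\<chi> i. 1) = real (\<Sum>i\<in>UNIV. \<alpha> $ i)"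
  by (simp add: inner_vec_def)

text \<open>The Motzkin form x^4 y^2 + x^2 y^4 + z^6 - 3 x^2 y^2 z^2 times z^(2m). The factor only
  shifts exponents, so the circuit structure survives in every even degree from 6 on. In half the
  Newton polytope, \<beta> splits only as twice (1, 1, m + 1).\<close>

lemma motzkin_not_sos:
  fixes i j k :: "'n::finite"
  assumes d: "i \<noteq> j" "i \<noteq> k" "j \<noteq> k"
  shows "\<exists>g :: 'n poly_n. nonneg_circuit (2 * m + 6) g \<and> (\<forall>rs. g \<noteq> (\<Sum>r\<leftarrow>rs. r ^ 2))"
proof -
  define a1 a2 a3 \<beta> :: "nat ^ 'n"
    where "a1 = axis i 4 + axis j 2 + axis k (2 * m)"
      and "a2 = axis i 2 + axis j 4 + axis k (2 * m)"
      and "a3 = axis k (2 * m + 6)"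
      and "\<beta> = axis i 2 + axis j 2 + axis k (2 * m + 2)"
  let ?A = "{a1, a2, a3}"
  note defs = a1_def a2_def a3_def \<beta>_def
  have c: "a1 $ i = 4" "a1 $ j = 2" "a1 $ k = 2 * m" "a2 $ i = 2" "a2 $ j = 4" "a2 $ k = 2 * m"
    "a3 $ i = 0" "a3 $ j = 0" "a3 $ k = 2 * m + 6" "\<beta> $ i = 2" "\<beta> $ j = 2" "\<beta> $ k = 2 * m + 2"
    using d by (auto simp: defs axis_def)
  have c': "a1 $ l = 0" "a2 $ l = 0" "a3 $ l = 0" "\<beta> $ l = 0" if "l \<notin> {i, j, k}" for l
    using that by (auto simp: defs axis_def)
  have ne: "a1 \<noteq> a2" "a1 \<noteq> a3" "a2 \<noteq> a3" "\<beta> \<noteq> a1" "\<beta> \<noteq> a2" "\<beta> \<noteq> a3"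
    using c by (metis numeral_eq_iff semiring_norm(83,85,87,88) zero_neq_numeral)+
  have card: "card ?A = 3" using ne by simp
  have sums: "(\<Sum>l\<in>UNIV. a1 $ l) = 2 * m + 6" "(\<Sum>l\<in>UNIV. a2 $ l) = 2 * m + 6"
    "(\<Sum>l\<in>UNIV. a3 $ l) = 2 * m + 6" "(\<Sum>l\<in>UNIV. \<beta> $ l) = 2 * m + 6"
    by (simp_all add: defs sum.distrib)
  have "circuit (2 * m + 6) (amgm_form ?A \<beta>)"
  proof (rule circuit_amgm_form)
    show "even (\<alpha> $ l)" if "\<alpha> \<in> ?A" for \<alpha> l
      using that by (auto simp: defs axis_def)
    show "card ?A * \<beta> $ l = (\<Sum>\<alpha>\<in>?A. \<alpha> $ l)" for l
      using c c'[of l] ne card by (cases "l \<in> {i, j, k}") auto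
    show "U \<alpha> = 0" if U: "sum U ?A = 0" "\<And>l. (\<Sum>\<alpha>\<in>?A. U \<alpha> * real (\<alpha> $ l)) = 0"
      and \<alpha>: "\<alpha> \<in> ?A" for U \<alpha>
    proof -
      have "U a1 * 4 + U a2 * 2 = 0" using U(2)[of i] ne c by simp
      moreover have "U a1 * 2 + U a2 * 4 = 0" using U(2)[of j] ne c by simp
      moreover have "U a1 + U a2 + U a3 = 0" using U(1) ne by (simp add: add.assoc)
      ultimately have "U a1 = 0 \<and> U a2 = 0 \<and> U a3 = 0" by linarith
      then show ?thesis using \<alpha> by auto
    qed
  qed (use ne sums in auto)
  moreover have "peval (amgm_form ?A \<beta>) x \<ge> 0" for x
  proof -
    define X Y Z where "X = x $ i" and "Y = x $ j" and "Z = x $ k"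
    have "peval (amgm_form ?A \<beta>) x =
      X ^ 4 * Y ^ 2 * Z ^ (2 * m) + (X ^ 2 * Y ^ 4 * Z ^ (2 * m) + Z ^ (2 * m + 6))
      - 3 * (X ^ 2 * Y ^ 2 * Z ^ (2 * m + 2))"
      unfolding peval_amgm_form card using ne
      by (simp only: sum.insert finite_insert finite.emptyI insert_iff empty_iff sum.empty simp_thms)
        (simp add: defs mon_add X_def Y_def Z_def)
    also have "\<dots> = (Z ^ m) ^ 2 * (X ^ 4 * Y ^ 2 + X ^ 2 * Y ^ 4 + Z ^ 6 - 3 * (X ^ 2 * Y ^ 2 * Z ^ 2))"
    proof -
      have "Z ^ (2 * m) = (Z ^ m) ^ 2" "Z ^ (2 * m + 2) = (Z ^ m) ^ 2 * Z ^ 2"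
        "Z ^ (2 * m + 6) = (Z ^ m) ^ 2 * Z ^ 6"
        by (simp_all only: power_add power_even_eq)
      then show ?thesis by (simp only: algebra_simps)
    qed
    \<comment> \<open>With a = |X|, b = |Y|, t = Z^2: the first square changes a^2 + b^2 into 2ab,
      and t^3 + 2(ab)^3 - 3t(ab)^2 = (t - ab)^2 (t + 2ab).\<close>
    also have "X ^ 4 * Y ^ 2 + X ^ 2 * Y ^ 4 + Z ^ 6 - 3 * (X ^ 2 * Y ^ 2 * Z ^ 2) =
      (X * Y) ^ 2 * (\<bar>X\<bar> - \<bar>Y\<bar>) ^ 2 + (Z ^ 2 - \<bar>X * Y\<bar>) ^ 2 * (Z ^ 2 + 2 * \<bar>X * Y\<bar>)"
    proof -
      have id: "a ^ 2 * (a * b) ^ 2 + b ^ 2 * (a * b) ^ 2 + t ^ 3 - 3 * ((a * b) ^ 2 * t) =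
        (a * b) ^ 2 * (a - b) ^ 2 + (t - a * b) ^ 2 * (t + 2 * (a * b))" for a b t :: real
        by (simp add: power2_eq_square power3_eq_cube algebra_simps)
      have "X ^ 4 = X ^ 2 * X ^ 2" "Y ^ 4 = Y ^ 2 * Y ^ 2" "Z ^ 6 = (Z ^ 2) ^ 3"
        by (simp_all flip: power_add power_mult)
      then show ?thesis using id[of "\<bar>X\<bar>" "\<bar>Y\<bar>" "Z ^ 2"]
        by (simp add: abs_mult power_mult_distrib mult_ac)
    qed
    also have "(Z ^ m) ^ 2 * \<dots> \<ge> 0" by (intro mult_nonneg_nonneg add_nonneg_nonneg) auto
    finally show ?thesis .
  qed
  moreover have "amgm_form ?A \<beta> \<noteq> (\<Sum>r\<leftarrow>rs. r ^ 2)" for rs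
  proof (rule negative_coefficient_not_sos)
    show "Poly_Mapping.lookup (amgm_form ?A \<beta>) \<beta> < 0"
      using ne card by (simp add: lookup_amgm_form)
    fix r a b
    assume r: "\<And>x. peval r x ^ 2 \<le> peval (amgm_form ?A \<beta>) x"
      and ab: "a \<in> Poly_Mapping.keys r" "b \<in> Poly_Mapping.keys r" "a + b = \<beta>"
    \<comment> \<open>Each inequality is linear. Its doubled version holds at the four exponents of
      the form, so \<open>amgm_growth\<close> in the corresponding direction passes it on to
      r.\<close>
    have key: "\<alpha> $ i \<le> 2 * \<alpha> $ j \<and> \<alpha> $ j \<le> 2 * \<alpha> $ i \<and> m \<le> \<alpha> $ k \<and> \<alpha> $ i + \<alpha> $ j + \<alpha> $ k \<le> m + 3"
      if "\<alpha> \<in> Poly_Mapping.keys r" for \<alpha>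
    proof -
      have A: "\<forall>\<gamma>\<in>insert \<beta> ?A. \<gamma> $ i \<le> 2 * \<gamma> $ j \<and> \<gamma> $ j \<le> 2 * \<gamma> $ i \<and> 2 * m \<le> \<gamma> $ k \<and>
        (\<Sum>l\<in>UNIV. \<gamma> $ l) = 2 * m + 6"
        by (simp add: c sums)
      note growth = amgm_growth[OF _ r _ that]
      have "real_exponent \<alpha> \<bullet> (axis i 1 - axis j 2) \<le> 0"
      proof (rule growth)
        fix \<gamma> assume "\<gamma> \<in> insert \<beta> ?A"
        then have "\<gamma> $ i \<le> 2 * \<gamma> $ j" using A by blast
        then show "real_exponent \<gamma> \<bullet> (axis i 1 - axis j 2) \<le> 2 * 0"
          by (simp add: inner_diff_right inner_axis)
      qed simp
      then have 1: "\<alpha> $ i \<le> 2 * \<alpha> $ j" by (simp add: inner_diff_right inner_axis)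
      have "real_exponent \<alpha> \<bullet> (axis j 1 - axis i 2) \<le> 0"
      proof (rule growth)
        fix \<gamma> assume "\<gamma> \<in> insert \<beta> ?A"
        then have "\<gamma> $ j \<le> 2 * \<gamma> $ i" using A by blast
        then show "real_exponent \<gamma> \<bullet> (axis j 1 - axis i 2) \<le> 2 * 0"
          by (simp add: inner_diff_right inner_axis)
      qed simp
      then have 2: "\<alpha> $ j \<le> 2 * \<alpha> $ i" by (simp add: inner_diff_right inner_axis)
      have "real_exponent \<alpha> \<bullet> axis k (-1) \<le> - real m"
      proof (rule growth)
        fix \<gamma> assume "\<gamma> \<in> insert \<beta> ?A"
        then have "2 * m \<le> \<gamma> $ k" using A by blast
        then show "real_exponent \<gamma> \<bullet> axis k (-1) \<le> 2 * - real m"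
          by (simp add: inner_axis)
      qed simp
      then have 3: "m \<le> \<alpha> $ k" by (simp add: inner_axis)
      have "real_exponent \<alpha> \<bullet> (\<chi> i. 1) \<le> real (m + 3)"
      proof (rule growth)
        fix \<gamma> assume "\<gamma> \<in> insert \<beta> ?A"
        then have "(\<Sum>l\<in>UNIV. \<gamma> $ l) = 2 * m + 6" using A by blast
        then show "real_exponent \<gamma> \<bullet> (\<chi> i. 1) \<le> 2 * real (m + 3)" unfolding inner_one by simp
      qed simp
      then have "(\<Sum>l\<in>UNIV. \<alpha> $ l) \<le> m + 3" unfolding inner_one by linarith
      moreover have "(\<Sum>l\<in>{i, j, k}. \<alpha> $ l) \<le> (\<Sum>l\<in>UNIV. \<alpha> $ l)" by (rule sum_mono2) auto
      ultimately show ?thesis using 1 2 3 d by simp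
    qed
    have eqs: "a $ l + b $ l = \<beta> $ l" for l using ab(3) by (metis vector_add_component)
    note ka = key[OF ab(1)] and kb = key[OF ab(2)] and eqs_ijk = eqs[of i, unfolded c]
      eqs[of j, unfolded c] eqs[of k, unfolded c]
    \<comment> \<open>If a_i = 0 then a_j = 0, and b would have entries 2, 2 and at least m,
      exceeding the degree m + 3; likewise with a and b exchanged.\<close>
    have "a $ i \<noteq> 0" "b $ i \<noteq> 0" using ka kb eqs_ijk by linarith+
    then have i1: "a $ i = 1" "b $ i = 1" using eqs_ijk by linarith+
    then have "a $ j \<noteq> 0" "b $ j \<noteq> 0" using ka kb by linarith+
    then have j1: "a $ j = 1" "b $ j = 1" using eqs_ijk by linarith+
    have "a $ k = b $ k" using ka kb i1 j1 eqs_ijk by linarith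
    then have "a $ i = b $ i \<and> a $ j = b $ j \<and> a $ k = b $ k" using i1 j1 by simp
    moreover have "a $ l = b $ l" if "l \<notin> {i, j, k}" for l using eqs[of l] c'[OF that] by simp
    ultimately show "a = b" unfolding vec_eq_iff by (metis insertCI insertE singletonD)
  qed
  ultimately show ?thesis by (auto simp: nonneg_circuit_def)
qed

text \<open>The Choi-Lam form w^4 + x^2 y^2 + y^2 z^2 + x^2 z^2 - 4xyzw. Exponents of r have degree
  at most 2 and obey the triangle inequalities in x, y, z. If \<beta> were a sum of two of them, one
  would contain w; the inequalities make its other entries 0, and its partner would then contain
  xyz, of degree 3.\<close>

lemma choi_lam_not_sos:
  fixes i j k p :: "'n::finite"
  assumes d: "i \<noteq> j" "i \<noteq> k" "j \<noteq> k" "p \<noteq> i" "p \<noteq> j" "p \<noteq> k"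
  shows "\<exists>g :: 'n poly_n. nonneg_circuit 4 g \<and> (\<forall>rs. g \<noteq> (\<Sum>r\<leftarrow>rs. r ^ 2))"
proof -
  define a1 a2 a3 a4 \<beta> :: "nat ^ 'n"
    where "a1 = axis p 4"
      and "a2 = axis i 2 + axis j 2"
      and "a3 = axis j 2 + axis k 2"
      and "a4 = axis i 2 + axis k 2"
      and "\<beta> = axis i 1 + axis j 1 + axis k 1 + axis p 1"
  let ?A = "{a1, a2, a3, a4}"
  note defs = a1_def a2_def a3_def a4_def \<beta>_def
  have c: "a1 $ i = 0" "a1 $ j = 0" "a1 $ k = 0" "a1 $ p = 4"
    "a2 $ i = 2" "a2 $ j = 2" "a2 $ k = 0" "a2 $ p = 0"
    "a3 $ i = 0" "a3 $ j = 2" "a3 $ k = 2" "a3 $ p = 0"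
    "a4 $ i = 2" "a4 $ j = 0" "a4 $ k = 2" "a4 $ p = 0"
    "\<beta> $ i = 1" "\<beta> $ j = 1" "\<beta> $ k = 1" "\<beta> $ p = 1"
    using d by (auto simp: defs axis_def)
  have c': "a1 $ l = 0" "a2 $ l = 0" "a3 $ l = 0" "a4 $ l = 0" "\<beta> $ l = 0" if "l \<notin> {i, j, k, p}" for l
    using that by (auto simp: defs axis_def)
  have ne: "a1 \<noteq> a2" "a1 \<noteq> a3" "a1 \<noteq> a4" "a2 \<noteq> a3" "a2 \<noteq> a4" "a3 \<noteq> a4"
    "\<beta> \<noteq> a1" "\<beta> \<noteq> a2" "\<beta> \<noteq> a3" "\<beta> \<noteq> a4"
    using c by (metis one_neq_zero zero_neq_numeral)+
  have card: "card ?A = 4" using ne by simp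
  have sums: "(\<Sum>l\<in>UNIV. a1 $ l) = 4" "(\<Sum>l\<in>UNIV. a2 $ l) = 4"
    "(\<Sum>l\<in>UNIV. a3 $ l) = 4" "(\<Sum>l\<in>UNIV. a4 $ l) = 4" "(\<Sum>l\<in>UNIV. \<beta> $ l) = 4"
    by (simp_all add: defs sum.distrib)
  have "circuit 4 (amgm_form ?A \<beta>)"
  proof (rule circuit_amgm_form)
    show "even (\<alpha> $ l)" if "\<alpha> \<in> ?A" for \<alpha> l
      using that by (auto simp: a1_def a2_def a3_def a4_def axis_def)
    show "card ?A * \<beta> $ l = (\<Sum>\<alpha>\<in>?A. \<alpha> $ l)" for l
      using c c'[of l] ne card by (cases "l \<in> {i, j, k, p}") auto
    show "U \<alpha> = 0" if U: "sum U ?A = 0" "\<And>l. (\<Sum>\<alpha>\<in>?A. U \<alpha> * real (\<alpha> $ l)) = 0"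
      and \<alpha>: "\<alpha> \<in> ?A" for U \<alpha>
    proof -
      have "U a2 + U a4 = 0" using U(2)[of i] ne c by simp
      moreover have "U a2 + U a3 = 0" using U(2)[of j] ne c by simp
      moreover have "U a3 + U a4 = 0" using U(2)[of k] ne c by simp
      moreover have "U a1 = 0" using U(2)[of p] ne c by simp
      ultimately have "U a1 = 0 \<and> U a2 = 0 \<and> U a3 = 0 \<and> U a4 = 0" by linarith
      then show ?thesis using \<alpha> by auto
    qed
  qed (use ne sums in auto)
  moreover have "peval (amgm_form ?A \<beta>) x \<ge> 0" for x
  proof -
    define X Y Z W where "X = x $ i" and "Y = x $ j" and "Z = x $ k" and "W = x $ p"
    have "peval (amgm_form ?A \<beta>) x =
      W ^ 4 + (X ^ 2 * Y ^ 2 + (Y ^ 2 * Z ^ 2 + X ^ 2 * Z ^ 2)) - 4 * (X * Y * Z * W)"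
      unfolding peval_amgm_form card using ne
      by (simp only: sum.insert finite_insert finite.emptyI insert_iff empty_iff sum.empty simp_thms)
        (simp add: defs mon_add X_def Y_def Z_def W_def)
    \<comment> \<open>AM-GM in two rounds: w^4 + a^2 b^2 and b^2 z^2 + a^2 z^2 are compared with 2ab
      w^2 and 2ab z^2, and these with 4abzw. The last summand restores the signs.\<close>
    also have "\<dots> = (W ^ 2 - \<bar>X * Y\<bar>) ^ 2 + (\<bar>Y * Z\<bar> - \<bar>X * Z\<bar>) ^ 2
      + 2 * \<bar>X * Y\<bar> * (\<bar>Z\<bar> - \<bar>W\<bar>) ^ 2 + 4 * (\<bar>X * Y * Z * W\<bar> - X * Y * Z * W)"
    proof -
      have id: "w ^ 4 + (a ^ 2 * b ^ 2 + (b ^ 2 * z ^ 2 + a ^ 2 * z ^ 2)) =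
        (w ^ 2 - a * b) ^ 2 + (b * z - a * z) ^ 2 + 2 * (a * b) * (z - w) ^ 2 + 4 * (a * b * z * w)"
        for a b z w :: real
        by algebra
      show ?thesis using id[of "\<bar>W\<bar>" "\<bar>X\<bar>" "\<bar>Y\<bar>" "\<bar>Z\<bar>"]
        by (simp add: abs_mult)
    qed
    also have "\<dots> \<ge> 0"
      by (intro mult_nonneg_nonneg add_nonneg_nonneg) (auto simp: abs_ge_self)
    finally show ?thesis .
  qed
  moreover have "amgm_form ?A \<beta> \<noteq> (\<Sum>r\<leftarrow>rs. r ^ 2)" for rs
  proof (rule negative_coefficient_not_sos)
    show "Poly_Mapping.lookup (amgm_form ?A \<beta>) \<beta> < 0"
      using ne card by (simp add: lookup_amgm_form)
    fix r a b
    assume r: "\<And>x. peval r x ^ 2 \<le> peval (amgm_form ?A \<beta>) x"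
      and ab: "a \<in> Poly_Mapping.keys r" "b \<in> Poly_Mapping.keys r" "a + b = \<beta>"
    have key: "\<alpha> $ i \<le> \<alpha> $ j + \<alpha> $ k \<and> \<alpha> $ j \<le> \<alpha> $ i + \<alpha> $ k \<and> \<alpha> $ k \<le> \<alpha> $ i + \<alpha> $ j \<and>
      \<alpha> $ i + \<alpha> $ j + \<alpha> $ k + \<alpha> $ p \<le> 2"
      if "\<alpha> \<in> Poly_Mapping.keys r" for \<alpha>
    proof -
      have tri: "\<alpha> $ l \<le> \<alpha> $ l' + \<alpha> $ l''"
        if "\<forall>a \<in> insert \<beta> ?A. a $ l \<le> a $ l' + a $ l''" for l l' l''
      proof -
        have "real_exponent \<alpha> \<bullet> (axis l 1 - axis l' 1 - axis l'' 1) \<le> 0"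
        proof (rule amgm_growth[OF _ r _ \<open>\<alpha> \<in> Poly_Mapping.keys r\<close>])
          fix \<gamma> assume "\<gamma> \<in> insert \<beta> ?A"
          then have "\<gamma> $ l \<le> \<gamma> $ l' + \<gamma> $ l''" using that by blast
          then show "real_exponent \<gamma> \<bullet> (axis l 1 - axis l' 1 - axis l'' 1) \<le> 2 * 0"
            by (simp add: inner_diff_right inner_axis)
        qed simp
        then show ?thesis by (simp add: inner_diff_right inner_axis)
      qed
      have "real_exponent \<alpha> \<bullet> (\<chi> i. 1) \<le> real 2"
      proof (rule amgm_growth[OF _ r _ that])
        fix \<gamma> assume "\<gamma> \<in> insert \<beta> ?A"
        then have "(\<Sum>l\<in>UNIV. \<gamma> $ l) = 4" using sums by blast
        then show "real_exponent \<gamma> \<bullet> (\<chi> i. 1) \<le> 2 * real 2" unfolding inner_one by simp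
      qed simp
      then have "(\<Sum>l\<in>UNIV. \<alpha> $ l) \<le> 2" unfolding inner_one by linarith
      moreover have "(\<Sum>l\<in>{i, j, k, p}. \<alpha> $ l) \<le> (\<Sum>l\<in>UNIV. \<alpha> $ l)" by (rule sum_mono2) auto
      ultimately show ?thesis using tri[of i j k] tri[of j i k] tri[of k i j] d by (simp add: c)
    qed
    have eqs: "a $ l + b $ l = \<beta> $ l" for l using ab(3) by (metis vector_add_component)
    have sum_le_1: "u = 0 \<and> v = 0 \<and> w = 0"
      if "u \<le> v + w" "v \<le> u + w" "w \<le> u + v" "u + v + w + 1 \<le> 2" for u v w :: nat
      using that by linarith
    have p: "a $ p = 1 \<or> b $ p = 1" using eqs[of p] unfolding c by arith
    have False
      using p
    proof
      assume "a $ p = 1"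
      then have "a $ i = 0 \<and> a $ j = 0 \<and> a $ k = 0"
        using key[OF ab(1)] by (intro sum_le_1) auto
      then show False using key[OF ab(2)] eqs[of i] eqs[of j] eqs[of k] unfolding c by linarith
    next
      assume "b $ p = 1"
      then have "b $ i = 0 \<and> b $ j = 0 \<and> b $ k = 0"
        using key[OF ab(2)] by (intro sum_le_1) auto
      then show False using key[OF ab(1)] eqs[of i] eqs[of j] eqs[of k] unfolding c by linarith
    qed
    then show "a = b" ..
  qed
  ultimately show ?thesis by (auto simp: nonneg_circuit_def)
qed

lemma obtain_distinct_elements:
  assumes "card (UNIV :: 'n::finite set) \<ge> m"
  obtains xs :: "'n::finite list" where "distinct xs" "length xs = m"
proof -
  obtain xs :: "'n list" where xs: "set xs = UNIV" "distinct xs"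
    using finite_distinct_list[OF finite[of UNIV]] by blast
  then have "length xs \<ge> m" using assms distinct_card[of xs] by simp
  then show ?thesis using xs by (intro that[of "take m xs"]) auto
qed

text \<open>The non-Hilbert cases are n \<ge> 3 with 2d \<ge> 6, served by multiples of the Motzkin
  form, and n \<ge> 4 with 2d = 4, served by the Choi-Lam form.\<close>

lemma non_hilbert_case_product:
  assumes n: "CARD('n::finite) \<ge> 2" and d: "d \<ge> 1" and nh: "\<not> hilbert_case CARD('n) (2 * d)"
  shows "\<exists>f g :: 'n poly_n. f \<in> forms d \<and> nonneg_circuit (2 * d) g \<and>
    f ^ 2 * g \<notin> sos_plus_sonc (4 * d)"
proof -
  have n3: "CARD('n) \<ge> 3" and d2: "d \<ge> 2" and "CARD('n) \<ge> 4 \<or> d \<ge> 3"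
    using assms by (auto simp: hilbert_case_def)
  then consider "d \<ge> 3" | "CARD('n) \<ge> 4" "d = 2" by fastforce
  then have "\<exists>(i :: 'n) j k (g :: 'n poly_n). i \<noteq> j \<and> i \<noteq> k \<and> j \<noteq> k \<and>
    nonneg_circuit (2 * d) g \<and> (\<forall>rs. g \<noteq> (\<Sum>r\<leftarrow>rs. r ^ 2))"
  proof cases
    case 1
    obtain xs :: "'n list" where "distinct xs" "length xs = 3"
      using obtain_distinct_elements[OF n3] by blast
    then obtain i j k :: 'n where ijk: "i \<noteq> j" "i \<noteq> k" "j \<noteq> k"
      by (auto simp: numeral_3_eq_3 length_Suc_conv)
    have "2 * (d - 3) + 6 = 2 * d" using 1 by simp
    then obtain g :: "'n poly_n" where "nonneg_circuit (2 * d) g" "\<forall>rs. g \<noteq> (\<Sum>r\<leftarrow>rs. r ^ 2)"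
      using motzkin_not_sos[OF ijk, of "d - 3"] by auto
    then show ?thesis using ijk by blast
  next
    case 2
    obtain xs :: "'n list" where "distinct xs" "length xs = 4"
      using obtain_distinct_elements[OF 2(1)] by blast
    then obtain i j k p :: 'n where ijkp: "i \<noteq> j" "i \<noteq> k" "j \<noteq> k" "p \<noteq> i" "p \<noteq> j" "p \<noteq> k"
      by (auto simp: numeral_eq_Suc length_Suc_conv)
    then obtain g :: "'n poly_n" where "nonneg_circuit (2 * d) g" "\<forall>rs. g \<noteq> (\<Sum>r\<leftarrow>rs. r ^ 2)"
      using choi_lam_not_sos[OF ijkp] 2(2) by auto
    then show ?thesis using ijkp(1-3) by blast
  qed
  then obtain i j k :: 'n and g :: "'n poly_n" where ijk: "i \<noteq> j" "i \<noteq> k" "j \<noteq> k"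
    and g: "nonneg_circuit (2 * d) g" "\<And>rs. g \<noteq> (\<Sum>r\<leftarrow>rs. r ^ 2)" by blast
  have "linear3 i j k ^ d \<in> forms d"
    using forms_power[OF linear3_forms[of i j k], of d] by simp
  moreover have "(linear3 i j k ^ d) ^ 2 * g \<notin> sos_plus_sonc (4 * d)"
    using linear3_power_mult_sos_plus_sonc[OF ijk] g(2) d2 by (metis less_le_trans zero_less_numeral)
  ultimately show ?thesis using g(1) by blast
qed

theorem proposition4p10:
  fixes d :: nat
  assumes "CARD('n::finite) \<ge> 2" and "d \<ge> 1"
  shows "(sos_plus_sonc_mult_closed TYPE('n) d \<longleftrightarrow> hilbert_case CARD('n) (2 * d)) \<and>
    (\<not> hilbert_case CARD('n) (2 * d) \<longrightarrow>
      (\<exists>f g :: 'n poly_n. f \<in> forms d \<and> nonneg_circuit (2 * d) g \<and>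
         f ^ 2 * g \<notin> sos_plus_sonc (4 * d)))"
proof -
  have "\<not> sos_plus_sonc_mult_closed TYPE('n) d" if nh: "\<not> hilbert_case CARD('n) (2 * d)"
  proof -
    obtain f g :: "'n poly_n" where f: "f \<in> forms d" and g: "nonneg_circuit (2 * d) g"
      and fg: "f ^ 2 * g \<notin> sos_plus_sonc (4 * d)"
      using non_hilbert_case_product[OF assms nh] by blast
    \<comment> \<open>Both factors lie in the cone of degree 2d, one as a square and the other as a
      circuit, so their product refutes closedness.\<close>
    have "f ^ 2 \<in> sos_plus_sonc (2 * d)"
      using sos_forms_square[OF f] unfolding sos_plus_sonc_def
      by (auto intro: exI[of _ "f ^ 2"] exI[of _ 0])
    moreover have "g \<in> sonc_forms (2 * d)"
      using g unfolding sonc_forms_def by (auto intro!: exI[of _ "[g]"])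
    then have "g \<in> sos_plus_sonc (2 * d)"
      unfolding sos_plus_sonc_def by (auto intro: exI[of _ 0] exI[of _ g])
    ultimately show ?thesis using fg unfolding sos_plus_sonc_mult_closed_def by blast
  qed
  then show ?thesis
    using hilbert_case_mult_closed non_hilbert_case_product[OF assms] by blast
qed

end
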